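(* Let $M\subset A^r$ be a finitely generated graded right $A$-submodule with minimal homogeneous basis $g_1,\dots,g_s$, $\Delta_j=\deg g_j$, let $\varphi:\bigoplus_{j=1}^sA[-\Delta_j]\to A^r$, $\epsilon_j\mapsto g_j$, and $\varphi'=L(\varphi):\bigoplus_jS[-\Delta_j]\to S^r$, $\epsilon'_j\mapsto\iota(g_j)$. Let $K=\mathrm{Ker}\,\varphi$ (the right syzygies of $\{g_j\}$), $K'=\mathrm{Ker}\,\varphi'$, and let $C\subset\bigoplus_jS[-\Delta_j]$ be the $S$-submodule generated by the elements $\epsilon'_jx_{kl}$ with $1\le j\le s$, $1\le k\le n$, $1\le l\le\Delta_j$. Then $K'=C+L(K)$, and $b_d(K)=b_d(K')-b_d(C)$ for all $d\ge0$.
   Context: Let $\mathbb K$ be a field, $F=\mathbb K\langle x_1,\dots,x_n\rangle$ with standard grading, $I\subset F$ a graded two-sided ideal, $A=F/I$, $A[-\delta]_d=A_{d-\delta}$; $A^r$ has basis $e_i$ of degree $0$ and $\bigoplus_jA[-\Delta_j]$ has basis $\epsilon_j$ of degree $\Delta_j$. Minimal basis: homogeneous generating set none of whose elements lies in the submodule generated by the others; $b_d$ = number of degree-$d$ elements in a minimal homogeneous basis. Let $P=\mathbb K[x_{ij}\mid1\le i\le n,j\ge1]$ (commutative, $\deg x_{ij}=1$), $Q$ the ideal generated by all $x_{ij}x_{kj}$, $R=P/Q$, $\sigma:x_{ij}\mapsto x_{i,j+1}$, $\iota:F\to R$ the $\mathbb K$-linear map $x_{i_1}\cdots x_{i_d}\mapsto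 x_{i_11}\cdots x_{i_dd}$, $J$ the ideal generated by $\bigcup_{k\ge0}\sigma^k(\iota(I))$, $S=R/J$ (with induced $\sigma$ and induced injective linear $\iota:A\to S$); $x_{kl}$ also denotes its coset in $S$. $S^r$ and $\bigoplus_jS[-\Delta_j]$ are free $S$-modules with bases $e'_i$ (degree $0$) and $\epsilon'_j$ (degree $\Delta_j$). The module letterplace embedding of a graded free module $\bigoplus_iA[-\delta_i]$ into $\bigoplus_iS[-\delta_i]$ is $e_if\mapsto e'_i\sigma^{\delta_i}(\iota(f))$; for a graded right submodule $N$, $L(N)$ is the $S$-submodule generated by $\iota(N)$. *)

theory Defs
  imports Main "HOL-Library.Poly_Mapping" "HOL-Library.Function_Algebras"
begin

section \<open>The free algebra F = K<x_1..x_n> (letters = elements of a finite type 'x, n = CARD('x))\<close>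

definition ncpoly :: "('x list \<Rightarrow> 'k::zero) set" where
  "ncpoly = {f. finite {w. f w \<noteq> 0}}"

definition ncmult :: "('x list \<Rightarrow> 'k::semiring_0) \<Rightarrow> ('x list \<Rightarrow> 'k) \<Rightarrow> ('x list \<Rightarrow> 'k)" where
  "ncmult f g = (\<lambda>w. \<Sum>k\<le>length w. f (take k w) * g (drop k w))"

definition nc_hom_comp :: "nat \<Rightarrow> ('x list \<Rightarrow> 'k::zero) \<Rightarrow> ('x list \<Rightarrow> 'k)" where
  "nc_hom_comp d f = (\<lambda>w. if length w = d then f w else 0)"

definition nc_graded_ideal :: "('x list \<Rightarrow> 'k::semiring_0) set \<Rightarrow> bool" where
  "nc_graded_ideal I \<longleftrightarrow> I \<subseteq> ncpoly \<and> 0 \<in> I \<and>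
     (\<forall>f\<in>I. \<forall>g\<in>I. f + g \<in> I) \<and>
     (\<forall>f\<in>I. \<forall>a\<in>ncpoly. ncmult a f \<in> I \<and> ncmult f a \<in> I) \<and>
     (\<forall>f\<in>I. \<forall>d. nc_hom_comp d f \<in> I)"

text \<open>Free right modules of rank r over F: vectors indexed by i < r, zero beyond.
  Submodules of (free modules over) A = F/I are represented by their preimages in F^r.\<close>

definition ncvec :: "nat \<Rightarrow> (nat \<Rightarrow> 'x list \<Rightarrow> 'k::zero) set" where
  "ncvec r = {v. (\<forall>i<r. v i \<in> ncpoly) \<and> (\<forall>i\<ge>r. v i = 0)}"

text \<open>Preimage in F^r of the right A-submodule of A^r generated by the classes of G.\<close>
inductive_set nc_rsub :: "nat \<Rightarrow> ('x list \<Rightarrow> 'k::semiring_0) set \<Rightarrow> (nat \<Rightarrow> 'x list \<Rightarrow> 'k) set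
    \<Rightarrow> (nat \<Rightarrow> 'x list \<Rightarrow> 'k) set"
  for r :: nat and I :: "('x list \<Rightarrow> 'k) set" and G :: "(nat \<Rightarrow> 'x list \<Rightarrow> 'k) set" where
  gen: "v \<in> G \<Longrightarrow> v \<in> nc_rsub r I G"
| ideal: "v \<in> ncvec r \<Longrightarrow> (\<forall>i. v i \<in> I) \<Longrightarrow> v \<in> nc_rsub r I G"
| add: "v \<in> nc_rsub r I G \<Longrightarrow> u \<in> nc_rsub r I G \<Longrightarrow> v + u \<in> nc_rsub r I G"
| rmult: "v \<in> nc_rsub r I G \<Longrightarrow> a \<in> ncpoly \<Longrightarrow> (\<lambda>i. ncmult (v i) a) \<in> nc_rsub r I G"

definition nc_vhom :: "(nat \<Rightarrow> nat) \<Rightarrow> nat \<Rightarrow> (nat \<Rightarrow> 'x list \<Rightarrow> 'k::zero) \<Rightarrow> bool" where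
  "nc_vhom \<delta> d v \<longleftrightarrow> (\<forall>i w. v i w \<noteq> 0 \<longrightarrow> length w + \<delta> i = d)"

text \<open>B (a set of homogeneous representatives) is a minimal homogeneous basis of the
  submodule (with preimage) N of \<Oplus>_{i<r} A[-\<delta> i].\<close>
definition nc_minbasis :: "nat \<Rightarrow> ('x list \<Rightarrow> 'k::semiring_0) set \<Rightarrow> (nat \<Rightarrow> nat)
    \<Rightarrow> (nat \<Rightarrow> 'x list \<Rightarrow> 'k) set \<Rightarrow> (nat \<Rightarrow> 'x list \<Rightarrow> 'k) set \<Rightarrow> bool" where
  "nc_minbasis r I \<delta> N B \<longleftrightarrow> B \<subseteq> ncvec r \<and> (\<forall>b\<in>B. \<exists>d. nc_vhom \<delta> d b) \<and>
     nc_rsub r I B = N \<and> (\<forall>b\<in>B. b \<notin> nc_rsub r I (B - {b}))"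

text \<open>Variable x_{i,j} (paper: 1 \<le> j) is represented by the pair (i, j - 1), i.e. columns are
  0-based. Polynomials are finitely supported maps from monomials (exponent vectors) to K.\<close>

type_synonym ('x, 'k) lp = "(('x \<times> nat) \<Rightarrow>\<^sub>0 nat) \<Rightarrow>\<^sub>0 'k"

definition lpvar :: "'x \<Rightarrow> nat \<Rightarrow> ('x, 'k::comm_ring_1) lp" where
  "lpvar i j = Poly_Mapping.single (Poly_Mapping.single (i, j) 1) 1"

definition mdeg :: "(('x \<times> nat) \<Rightarrow>\<^sub>0 nat) \<Rightarrow> nat" where
  "mdeg m = (\<Sum>v\<in>Poly_Mapping.keys m. Poly_Mapping.lookup m v)"

definition lpmono :: "'x list \<Rightarrow> (('x \<times> nat) \<Rightarrow>\<^sub>0 nat)" where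
  "lpmono w = (\<Sum>k<length w. Poly_Mapping.single (w ! k, k) 1)"

definition lpiota :: "('x list \<Rightarrow> 'k::comm_ring_1) \<Rightarrow> ('x, 'k) lp" where
  "lpiota f = (\<Sum>w\<in>{w. f w \<noteq> 0}. Poly_Mapping.single (lpmono w) (f w))"

definition mshift :: "(('x \<times> nat) \<Rightarrow>\<^sub>0 nat) \<Rightarrow> (('x \<times> nat) \<Rightarrow>\<^sub>0 nat)" where
  "mshift m = (\<Sum>(i, j)\<in>Poly_Mapping.keys m. Poly_Mapping.single (i, Suc j) (Poly_Mapping.lookup m (i, j)))"

definition lpsigma :: "('x, 'k::comm_ring_1) lp \<Rightarrow> ('x, 'k) lp" where
  "lpsigma p = (\<Sum>m\<in>Poly_Mapping.keys p. Poly_Mapping.single (mshift m) (Poly_Mapping.lookup p m))"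

inductive_set cideal :: "'a::comm_ring_1 set \<Rightarrow> 'a set" for G :: "'a set" where
  gen: "g \<in> G \<Longrightarrow> g \<in> cideal G"
| zero: "0 \<in> cideal G"
| add: "a \<in> cideal G \<Longrightarrow> b \<in> cideal G \<Longrightarrow> a + b \<in> cideal G"
| mult: "a \<in> cideal G \<Longrightarrow> c * a \<in> cideal G"

text \<open>Preimage in P of the ideal Q + J of P defining S = R/J = P/(Q + J).\<close>
definition lpJ :: "('x list \<Rightarrow> 'k::comm_ring_1) set \<Rightarrow> ('x, 'k) lp set" where
  "lpJ I = cideal ({lpvar i j * lpvar k j | i k j. True} \<union>
                    {(lpsigma ^^ t) (lpiota f) | t f. f \<in> I})"

text \<open>Free S-modules: vectors of P-elements indexed by i < s, zero beyond; submodules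
  represented by preimages.\<close>
definition lpvec :: "nat \<Rightarrow> (nat \<Rightarrow> ('x, 'k::comm_ring_1) lp) set" where
  "lpvec s = {v. \<forall>i\<ge>s. v i = 0}"

inductive_set lp_sub :: "nat \<Rightarrow> ('x, 'k::comm_ring_1) lp set \<Rightarrow> (nat \<Rightarrow> ('x, 'k) lp) set
    \<Rightarrow> (nat \<Rightarrow> ('x, 'k) lp) set"
  for s :: nat and J :: "('x, 'k) lp set" and G :: "(nat \<Rightarrow> ('x, 'k) lp) set" where
  gen: "v \<in> G \<Longrightarrow> v \<in> lp_sub s J G"
| ideal: "v \<in> lpvec s \<Longrightarrow> (\<forall>i. v i \<in> J) \<Longrightarrow> v \<in> lp_sub s J G"
| add: "v \<in> lp_sub s J G \<Longrightarrow> u \<in> lp_sub s J G \<Longrightarrow> v + u \<in> lp_sub s J G"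
| smult: "v \<in> lp_sub s J G \<Longrightarrow> (\<lambda>i. c * v i) \<in> lp_sub s J G"

definition lp_vhom :: "(nat \<Rightarrow> nat) \<Rightarrow> nat \<Rightarrow> (nat \<Rightarrow> ('x, 'k::comm_ring_1) lp) \<Rightarrow> bool" where
  "lp_vhom \<delta> d v \<longleftrightarrow> (\<forall>i. \<forall>m\<in>Poly_Mapping.keys (v i). mdeg m + \<delta> i = d)"

definition lp_minbasis :: "nat \<Rightarrow> ('x, 'k::comm_ring_1) lp set \<Rightarrow> (nat \<Rightarrow> nat)
    \<Rightarrow> (nat \<Rightarrow> ('x, 'k) lp) set \<Rightarrow> (nat \<Rightarrow> ('x, 'k) lp) set \<Rightarrow> bool" where
  "lp_minbasis s J \<delta> N B \<longleftrightarrow> B \<subseteq> lpvec s \<and> (\<forall>b\<in>B. \<exists>d. lp_vhom \<delta> d b) \<and>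
     lp_sub s J B = N \<and> (\<forall>b\<in>B. b \<notin> lp_sub s J (B - {b}))"

definition lp_embed :: "(nat \<Rightarrow> nat) \<Rightarrow> (nat \<Rightarrow> 'x list \<Rightarrow> 'k::comm_ring_1) \<Rightarrow> (nat \<Rightarrow> ('x, 'k) lp)" where
  "lp_embed \<delta> v = (\<lambda>i. (lpsigma ^^ \<delta> i) (lpiota (v i)))"

end

theory Submission
  imports Defs "HOL.Vector_Spaces"
begin

text \<open>
  A monomial without repeated columns factors uniquely as \<open>w t\<close>, where \<open>w\<close> is the run of columns
  \<open>a, a + 1, \<dots>\<close> that it contains and \<open>t\<close> lies behind the first gap. For homogeneous \<open>f \<in> I\<close>, the
  element \<open>\<sigma>\<^sup>k (\<iota> f)\<close> occupies an interval of columns, so each of its monomial multiples changes either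
  the run or the part behind the gap, but never both.

  Choose a linear map \<open>\<psi> : F\<^sup>r \<rightarrow> F\<^sup>s\<close> that vanishes on \<open>I\<^sup>r\<close> and satisfies \<open>\<phi> \<psi> \<phi> = \<phi>\<close> modulo \<open>I\<close>. By
  the remark above, \<open>\<Psi> (w t) = L (\<psi> w) t\<close> maps \<open>J\<close> to \<open>J\<close>. Given a syzygy \<open>v \<in> K'\<close>, the monomials at
  \<open>\<epsilon>'\<^sub>j\<close> with one of the first \<open>\<Delta>\<^sub>j\<close> columns form an element of \<open>C\<close>. The others add up to some
  \<open>\<Sum> L (u) t\<close>, which is congruent to \<open>\<Sum> L (u - \<psi> (\<phi> u)) t \<in> L (K)\<close>, because \<open>\<Psi> (\<phi>' v)\<close> vanishes
  modulo \<open>J\<close>.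

  Reading off the runs that start at column \<open>\<Delta>\<^sub>j\<close> is a left inverse of \<open>L\<close> that kills \<open>C\<close>. The projection
  to the monomials with one of the first \<open>\<Delta>\<^sub>j\<close> columns is the identity on \<open>C\<close> and maps the multiples of
  \<open>L (K)\<close> to \<open>C \<mm>\<close>, as the minimality of the \<open>g\<^sub>j\<close> excludes constant terms in \<open>K\<close>. Hence the images of
  a minimal basis of \<open>K\<close> together with a minimal basis of \<open>C\<close> form a minimal basis of \<open>K'\<close>.
\<close>

section \<open>The free algebra\<close>

text \<open>Without these declarations, the simplifier turns \<open>f + h\<close> into a \<open>\<lambda>\<close>-term wherever
  \<open>f + h\<close> happens to be \<open>\<eta>\<close>-expanded.\<close>
declare plus_fun_apply [simp del] zero_fun_apply [simp del]

lemmas fun_at = plus_fun_apply zero_fun_apply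

definition ncmono :: "'x list \<Rightarrow> 'k::zero \<Rightarrow> 'x list \<Rightarrow> 'k" where
  "ncmono u c = (\<lambda>w. if w = u then c else 0)"

lemma ncmono_apply: "ncmono u c w = (if w = u then c else 0)"
  by (simp add: ncmono_def)

lemma ncmono_0 [simp]: "ncmono u 0 = 0"
  by (auto simp: ncmono_def fun_at)

lemma sum_fun_at: "(\<Sum>x\<in>X. f x) y = (\<Sum>x\<in>X. f x y)"
  for f :: "'a \<Rightarrow> 'b \<Rightarrow> 'c::comm_monoid_add"
  by (induction X rule: infinite_finite_induct) (auto simp: fun_at)

lemma ncpoly_0 [simp]: "0 \<in> ncpoly"
  by (simp add: ncpoly_def fun_at)

lemma ncpoly_add: "f \<in> ncpoly \<Longrightarrow> h \<in> ncpoly \<Longrightarrow> f + h \<in> ncpoly"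
  for f h :: "'x list \<Rightarrow> 'k::monoid_add"
  unfolding ncpoly_def
  by (auto simp: fun_at intro!: finite_subset[of "{w. f w + h w \<noteq> 0}" "{w. f w \<noteq> 0} \<union> {w. h w \<noteq> 0}"])

lemma ncpoly_mono [simp]: "ncmono u c \<in> ncpoly"
  by (auto simp: ncpoly_def ncmono_def)

lemma ncpoly_expand:
  fixes f :: "'x list \<Rightarrow> 'k::comm_monoid_add"
  assumes "f \<in> ncpoly"
  shows "f = (\<Sum>w\<in>{w. f w \<noteq> 0}. ncmono w (f w))"
proof
  fix v
  have "(\<Sum>w\<in>{w. f w \<noteq> 0}. ncmono w (f w) v) = (\<Sum>w\<in>{w. f w \<noteq> 0}. if w = v then f w else 0)"
    by (rule sum.cong) (auto simp: ncmono_def)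
  also have "\<dots> = f v"
    using assms by (simp add: ncpoly_def sum.delta')
  finally show "f v = (\<Sum>w\<in>{w. f w \<noteq> 0}. ncmono w (f w)) v"
    by (simp add: sum_fun_at)
qed

lemma ncpoly_induct [consumes 1, case_names zero mono add]:
  fixes f :: "'x list \<Rightarrow> 'k::comm_monoid_add"
  assumes "f \<in> ncpoly" and "P 0" and "\<And>w c. P (ncmono w c)"
    and "\<And>f h. f \<in> ncpoly \<Longrightarrow> h \<in> ncpoly \<Longrightarrow> P f \<Longrightarrow> P h \<Longrightarrow> P (f + h)"
  shows "P f"
proof -
  have "(\<Sum>w\<in>X. ncmono w (f w)) \<in> ncpoly \<and> P (\<Sum>w\<in>X. ncmono w (f w))" if "finite X" for X
    using that by (induction X) (auto intro: assms ncpoly_add)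
  then have "P (\<Sum>w\<in>{w. f w \<noteq> 0}. ncmono w (f w))"
    using assms(1) by (simp add: ncpoly_def)
  then show ?thesis
    by (subst ncpoly_expand[OF assms(1)])
qed

lemma ncmult_add_left: "ncmult (f + f') h = ncmult f h + ncmult f' h"
  by (auto simp: ncmult_def fun_eq_iff fun_at distrib_right sum.distrib)

lemma ncmult_add_right: "ncmult f (h + h') = ncmult f h + ncmult f h'"
  by (auto simp: ncmult_def fun_eq_iff fun_at distrib_left sum.distrib)

lemma ncmult_0_left [simp]: "ncmult 0 h = 0"
  by (auto simp: ncmult_def fun_eq_iff fun_at)

lemma ncmult_0_right [simp]: "ncmult f 0 = 0"
  by (auto simp: ncmult_def fun_eq_iff fun_at)

lemma ncmult_mono_mono [simp]: "ncmult (ncmono u c) (ncmono v d) = ncmono (u @ v) (c * d)"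
proof
  fix w
  have *: "take k w = u \<and> drop k w = v \<longleftrightarrow> k = length u \<and> w = u @ v" if "k \<le> length w" for k
    using that by (metis append_eq_conv_conj append_take_drop_id length_take min.absorb2)
  have "ncmult (ncmono u c) (ncmono v d) w
      = (\<Sum>k\<le>length w. if take k w = u \<and> drop k w = v then c * d else 0)"
    by (auto simp: ncmult_def ncmono_def intro!: sum.cong)
  also have "\<dots> = (\<Sum>k\<le>length w. if k = length u then (if w = u @ v then c * d else 0) else 0)"
    by (rule sum.cong) (use * in auto)
  also have "\<dots> = ncmono (u @ v) (c * d) w"
    by (auto simp: ncmono_def sum.delta)
  finally show "ncmult (ncmono u c) (ncmono v d) w = ncmono (u @ v) (c * d) w" .
qed

lemma ncmult_ncpoly: "f \<in> ncpoly \<Longrightarrow> h \<in> ncpoly \<Longrightarrow> ncmult f h \<in> ncpoly"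
proof (induction f rule: ncpoly_induct)
  case (mono w c)
  from mono show ?case
    by (induction h rule: ncpoly_induct) (auto simp: ncmult_add_right intro: ncpoly_add)
qed (auto simp: ncmult_add_left intro: ncpoly_add)

lemma ncmult_assoc:
  assumes "f \<in> ncpoly" "h \<in> ncpoly" "k \<in> ncpoly"
  shows "ncmult (ncmult f h) k = ncmult f (ncmult h k)"
  using assms
proof (induction f rule: ncpoly_induct)
  case (mono u c)
  then show ?case
  proof (induction h rule: ncpoly_induct)
    case (mono v d)
    then show ?case
      by (induction k rule: ncpoly_induct) (auto simp: ncmult_add_right mult.assoc)
  qed (auto simp: ncmult_add_left ncmult_add_right)
qed (auto simp: ncmult_add_left)

lemma ncmult_scalar_right: "ncmult f (ncmono [] c) = (\<lambda>w. f w * c)"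
proof
  fix w
  have "ncmult f (ncmono [] c) w = (\<Sum>k\<le>length w. if k = length w then f w * c else 0)"
    unfolding ncmult_def by (rule sum.cong) (auto simp: ncmono_def)
  then show "ncmult f (ncmono [] c) w = f w * c"
    by simp
qed

lemma ncmult_scalar_left: "ncmult (ncmono [] c) f = (\<lambda>w. c * f w)"
proof
  fix w
  have "ncmult (ncmono [] c) f w = (\<Sum>k\<le>length w. if k = 0 then c * f w else 0)"
    unfolding ncmult_def by (rule sum.cong) (auto simp: ncmono_def)
  then show "ncmult (ncmono [] c) f w = c * f w"
    by simp
qed

lemma ncmult_sum_left: "ncmult (\<Sum>x\<in>X. f x) h = (\<Sum>x\<in>X. ncmult (f x) h)"
  by (induction X rule: infinite_finite_induct) (auto simp: ncmult_add_left)

lemma ncmult_sum_right: "ncmult h (\<Sum>x\<in>X. f x) = (\<Sum>x\<in>X. ncmult h (f x))"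
  by (induction X rule: infinite_finite_induct) (auto simp: ncmult_add_right)

section \<open>Vectors over the free algebra and graded ideals\<close>

lemma ncvec_add: "v \<in> ncvec r \<Longrightarrow> u \<in> ncvec r \<Longrightarrow> v + u \<in> ncvec r"
  for v u :: "nat \<Rightarrow> 'x list \<Rightarrow> 'k::monoid_add"
  by (auto simp: ncvec_def fun_at intro!: ncpoly_add)

lemma ncvecD: "v \<in> ncvec r \<Longrightarrow> v i \<in> ncpoly"
  by (cases "i < r") (auto simp: ncvec_def)

lemma ncvec_beyond: "v \<in> ncvec r \<Longrightarrow> r \<le> i \<Longrightarrow> v i = 0"
  by (auto simp: ncvec_def)

definition ncunit :: "nat \<Rightarrow> 'x list \<Rightarrow> 'k::zero \<Rightarrow> nat \<Rightarrow> 'x list \<Rightarrow> 'k" where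
  "ncunit j w c = (\<lambda>i. if i = j then ncmono w c else 0)"

lemma ncunit_ncvec: "j < s \<Longrightarrow> ncunit j w c \<in> ncvec s"
  by (auto simp: ncunit_def ncvec_def)

definition nc_hom :: "nat \<Rightarrow> ('x list \<Rightarrow> 'k::zero) \<Rightarrow> bool" where
  "nc_hom e f \<longleftrightarrow> (\<forall>w. f w \<noteq> 0 \<longrightarrow> length w = e)"

text \<open>Represents the zero submodule of \<open>A^r\<close>, because submodules are given by
  their preimages in \<open>F^r\<close>.\<close>

definition IV :: "nat \<Rightarrow> ('x list \<Rightarrow> 'k::zero) set \<Rightarrow> (nat \<Rightarrow> 'x list \<Rightarrow> 'k) set" where
  "IV r I = {v \<in> ncvec r. \<forall>i. v i \<in> I}"

context
  fixes I :: "('x list \<Rightarrow> 'k::field) set"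
  assumes I: "nc_graded_ideal I"
begin

lemma ideal_ncpoly: "f \<in> I \<Longrightarrow> f \<in> ncpoly"
  and ideal_0: "0 \<in> I"
  and ideal_add: "f \<in> I \<Longrightarrow> h \<in> I \<Longrightarrow> f + h \<in> I"
  and ideal_left: "f \<in> I \<Longrightarrow> a \<in> ncpoly \<Longrightarrow> ncmult a f \<in> I"
  and ideal_right: "f \<in> I \<Longrightarrow> a \<in> ncpoly \<Longrightarrow> ncmult f a \<in> I"
  and ideal_comp: "f \<in> I \<Longrightarrow> nc_hom_comp d f \<in> I"
  using I by (auto simp: nc_graded_ideal_def)

lemma ideal_scale_left: "f \<in> I \<Longrightarrow> (\<lambda>w. c * f w) \<in> I"
  using ideal_left[of f "ncmono [] c"] by (simp add: ncmult_scalar_left)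

end

text \<open>Gradedness keeps the components of \<open>f\<close> in \<open>I\<close>, and
  \<open>f\<close> is the sum of its finitely many nonzero components. So additive properties may be
  checked on homogeneous elements, whose letterplace monomials all occupy the same interval of
  columns.\<close>

lemma ideal_hom_induct [consumes 2, case_names hom add]:
  fixes I :: "('x list \<Rightarrow> 'k::field) set"
  assumes I: "nc_graded_ideal I"
    and f: "f \<in> I" and hom: "\<And>e f. f \<in> I \<Longrightarrow> nc_hom e f \<Longrightarrow> P f"
    and add: "\<And>f h. f \<in> I \<Longrightarrow> h \<in> I \<Longrightarrow> P f \<Longrightarrow> P h \<Longrightarrow> P (f + h)"
  shows "P f"
proof -
  let ?D = "length ` {w. f w \<noteq> 0}"
  have fin: "finite ?D"
    using ideal_ncpoly[OF I f] by (simp add: ncpoly_def)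
  have "(\<Sum>d\<in>X. nc_hom_comp d f) \<in> I \<and> P (\<Sum>d\<in>X. nc_hom_comp d f)" if "finite X" for X
    using that
  proof (induction X)
    case empty
    have "nc_hom 0 0"
      by (simp add: nc_hom_def fun_at)
    then show ?case
      using hom[of 0 0] ideal_0[OF I] by simp
  next
    case (insert d X)
    have "nc_hom d (nc_hom_comp d f)"
      by (simp add: nc_hom_def nc_hom_comp_def)
    then have "nc_hom_comp d f \<in> I" "P (nc_hom_comp d f)"
      using ideal_comp[OF I f] hom by blast+
    then show ?case
      using insert by (auto simp only: sum.insert[OF insert(1,2)] intro!: ideal_add[OF I] add)
  qed
  from this[OF fin] have "P (\<Sum>d\<in>?D. nc_hom_comp d f)"
    by blast
  also have "(\<Sum>d\<in>?D. nc_hom_comp d f) = f"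
  proof
    fix w
    have "(\<Sum>d\<in>?D. nc_hom_comp d f w) = (\<Sum>d\<in>?D. if d = length w then f w else 0)"
      by (rule sum.cong) (auto simp: nc_hom_comp_def)
    also have "\<dots> = f w"
      using fin by (auto simp: sum.delta)
    finally show "(\<Sum>d\<in>?D. nc_hom_comp d f) w = f w"
      by (simp add: sum_fun_at)
  qed
  finally show ?thesis .
qed

context
  fixes I :: "('x list \<Rightarrow> 'k::field) set"
  assumes I: "nc_graded_ideal I"
begin

text \<open>A nonzero constant is a unit, so \<open>A\<close> is zero. This disposes of blocks of
  length 0, which occupy no column and thus have no position relative to a run.\<close>

lemma ideal_degree_0:
  assumes "f \<in> I" "nc_hom 0 f" "f \<noteq> 0"
  shows "I = ncpoly"
proof
  show "ncpoly \<subseteq> I"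
  proof
    fix h :: "'x list \<Rightarrow> 'k"
    assume h: "h \<in> ncpoly"
    obtain c where c: "c \<noteq> 0" and f: "f = ncmono [] c"
    proof (rule that)
      show "f = ncmono [] (f [])"
        using assms(2) by (auto simp: nc_hom_def ncmono_def fun_eq_iff)
      then show "f [] \<noteq> 0"
        using assms(3) by (metis ncmono_0)
    qed
    have "ncmult f (ncmono [] (inverse c)) \<in> I"
      by (rule ideal_right[OF I]) (use assms in auto)
    then have "ncmono [] 1 \<in> I"
      using c by (simp add: f)
    from ideal_left[OF I this h] show "h \<in> I"
      by (simp add: ncmult_scalar_right)
  qed
qed (use ideal_ncpoly[OF I] in auto)

lemma IV_add: "v \<in> IV r I \<Longrightarrow> u \<in> IV r I \<Longrightarrow> v + u \<in> IV r I"
  by (auto simp: IV_def fun_at intro: ncvec_add ideal_add[OF I])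

lemma IV_0: "0 \<in> IV r I"
  by (auto simp: IV_def ncvec_def fun_at intro: ideal_0[OF I])

end

text \<open>Unlike the induction rule of \<open>nc_rsub\<close>, this one suits maps that are additive but not
  compatible with the right multiplication.\<close>
lemma nc_rsub_additive_induct [consumes 3, case_names ideal add mono]:
  fixes I :: "('x list \<Rightarrow> 'k::field) set"
  assumes I: "nc_graded_ideal I" and v: "v \<in> nc_rsub r I G" and G: "G \<subseteq> ncvec r"
    and ideal: "\<And>v. v \<in> IV r I \<Longrightarrow> P v"
    and add: "\<And>v u. v \<in> nc_rsub r I G \<Longrightarrow> u \<in> nc_rsub r I G \<Longrightarrow> P v \<Longrightarrow> P u \<Longrightarrow> P (v + u)"
    and mono: "\<And>b w c. b \<in> G \<Longrightarrow> P (\<lambda>i. ncmult (b i) (ncmono w c))"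
  shows "P v"
proof -
  have sub: "v \<in> ncvec r" if "v \<in> nc_rsub r I G" for v
    using that proof induction
    case (rmult v a)
    then show ?case
      by (auto simp: ncvec_def ncmult_ncpoly)
  qed (use G in \<open>auto intro: ncvec_add\<close>)
  \<comment> \<open>Quantifying over all right multiples turns the case of \<open>rmult\<close> into
    associativity; taking the unit for \<open>a\<close> recovers the claim.\<close>
  have "\<forall>a\<in>ncpoly. P (\<lambda>i. ncmult (v i) a)"
    using v
  proof induction
    case (gen b)
    show ?case
    proof
      fix a :: "'x list \<Rightarrow> 'k"
      assume "a \<in> ncpoly"
      then show "P (\<lambda>i. ncmult (b i) a)"
      proof (induction a rule: ncpoly_induct)
        case zero
        then show ?case
          using ideal[OF IV_0[OF I]] by (simp add: zero_fun_def[where ?'a = nat])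
      next
        case (mono w c)
        then show ?case
          using assms(6) gen by blast
      next
        case (add f h)
        have "P ((\<lambda>i. ncmult (b i) f) + (\<lambda>i. ncmult (b i) h))"
          using add gen by (intro assms(5) nc_rsub.rmult nc_rsub.gen[OF gen])
        then show ?case
          by (simp add: ncmult_add_right plus_fun_def[where ?'a = nat])
      qed
    qed
  next
    case (ideal v)
    then show ?case
      by (auto intro!: assms(4) simp: IV_def ncvec_def ncmult_ncpoly ideal_right[OF I])
  next
    case (add v u)
    show ?case
    proof
      fix a :: "'x list \<Rightarrow> 'k"
      assume a: "a \<in> ncpoly"
      have "P ((\<lambda>i. ncmult (v i) a) + (\<lambda>i. ncmult (u i) a))"
        using add a by (intro assms(5) nc_rsub.rmult) auto
      then show "P (\<lambda>i. ncmult ((v + u) i) a)"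
        by (simp add: ncmult_add_left plus_fun_def[where ?'a = nat])
    qed
  next
    case (rmult v a)
    then show ?case
      using ncvecD[OF sub[OF rmult(1)]] by (simp add: ncmult_assoc ncmult_ncpoly)
  qed
  from this[rule_format, of "ncmono [] 1"] show ?thesis
    by (simp add: ncmult_scalar_right)
qed

section \<open>Monomials and runs of columns\<close>

type_synonym 'x lpm = "('x \<times> nat) \<Rightarrow>\<^sub>0 nat"

text \<open>The exponent of the monomial \<open>\<sigma>\<^sup>a (\<iota> w)\<close>, with columns
  counted from 0.\<close>

definition colw :: "nat \<Rightarrow> 'x list \<Rightarrow> 'x lpm" where
  "colw a w = (\<Sum>k<length w. Poly_Mapping.single (w ! k, a + k) 1)"

lemma lookup_colw:
  "Poly_Mapping.lookup (colw a w) (i, j)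
    = (if a \<le> j \<and> j < a + length w \<and> w ! (j - a) = i then 1 else 0)"
proof -
  \<comment> \<open>Subtraction on naturals is truncated: for \<open>j < a\<close> the index
    \<open>j - a\<close> is 0, so \<open>a \<le> j\<close> has to be tested separately.\<close>
  have *: "Poly_Mapping.lookup (Poly_Mapping.single (w ! k, a + k) (1::nat)) (i, j)
      = (if k = j - a then (if a \<le> j \<and> w ! (j - a) = i then 1 else 0) else 0)" for k
  proof (cases "a \<le> j")
    case True
    then have "a + k = j \<longleftrightarrow> k = j - a"
      by linarith
    with True show ?thesis
      by (simp only: lookup_single when_def prod.inject) simp
  next
    case False
    then have "a + k \<noteq> j"
      by linarith
    with False show ?thesis
      by (simp add: lookup_single when_def)
  qed
  have "Poly_Mapping.lookup (colw a w) (i, j)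
      = (\<Sum>k<length w. if k = j - a then (if a \<le> j \<and> w ! (j - a) = i then 1 else 0) else 0)"
    unfolding colw_def lookup_sum * ..
  also have "\<dots> = (if j - a < length w then (if a \<le> j \<and> w ! (j - a) = i then 1 else 0) else 0)"
    by (simp only: sum.delta finite_lessThan lessThan_iff)
  also have "\<dots> = (if a \<le> j \<and> j < a + length w \<and> w ! (j - a) = i then 1 else 0)"
    by (simp add: less_diff_conv2 add.commute)
  finally show ?thesis .
qed

lemma lookup_colw_nth: "k < length w \<Longrightarrow> Poly_Mapping.lookup (colw a w) (w ! k, a + k) = 1"
  by (simp add: lookup_colw)

lemma colw_Nil [simp]: "colw a [] = 0"
  by (simp add: colw_def)

lemma colw_single: "colw a [x] = Poly_Mapping.single (x, a) 1"
  by (simp add: colw_def)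

lemma colw_append: "colw a (u @ v) = colw a u + colw (a + length u) v"
proof (rule poly_mapping_eqI)
  fix x :: "'a \<times> nat"
  obtain i j where x: "x = (i, j)"
    by fastforce
  show "Poly_Mapping.lookup (colw a (u @ v)) x = Poly_Mapping.lookup (colw a u + colw (a + length u) v) x"
    unfolding x lookup_add lookup_colw by (auto simp: nth_append add.commute)
qed

lemma lpmono_colw: "lpmono w = colw 0 w"
  by (simp add: lpmono_def colw_def)

section \<open>Degrees, shifts and factors of column monomials\<close>

lemma mdeg_add: "mdeg (m + m') = mdeg m + mdeg m'"
  unfolding mdeg_def by (rule setsum_keys_plus_distrib) auto

lemma mdeg_0 [simp]: "mdeg 0 = 0"
  by (simp add: mdeg_def)

lemma mdeg_single [simp]: "mdeg (Poly_Mapping.single x n) = n"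
  by (simp add: mdeg_def)

lemma mdeg_colw [simp]: "mdeg (colw a w) = length w"
proof -
  have "mdeg (\<Sum>k<n. Poly_Mapping.single (w ! k, a + k) 1) = n" for n
    by (induction n) (auto simp: mdeg_add)
  then show ?thesis
    by (simp add: colw_def)
qed

lemma mdeg_eq_0: "mdeg m = 0 \<longleftrightarrow> m = 0"
  by (auto simp: mdeg_def in_keys_iff intro: poly_mapping_eqI)

lemma lpm_add_eq_0: "m + m' = 0 \<longleftrightarrow> m = 0 \<and> m' = 0"
  for m m' :: "'x lpm"
  by (metis add_is_0 mdeg_add mdeg_eq_0)

lemma mshift_add: "mshift (m + m') = mshift m + mshift m'"
  unfolding mshift_def
  using setsum_keys_plus_distrib[of "\<lambda>(i, j) n. Poly_Mapping.single (i, Suc j) n" m m']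
  by (simp add: case_prod_beta single_add)

lemma mshift_single: "mshift (Poly_Mapping.single (i, j) n) = Poly_Mapping.single (i, Suc j) n"
  by (simp add: mshift_def)

lemma mshift_colw: "mshift (colw a w) = colw (Suc a) w"
proof -
  have "mshift (\<Sum>k<n. Poly_Mapping.single (w ! k, a + k) 1)
      = (\<Sum>k<n. Poly_Mapping.single (w ! k, Suc a + k) 1)" for n
    by (induction n) (auto simp: mshift_add mshift_single, simp add: mshift_def)
  then show ?thesis
    by (simp add: colw_def)
qed

lemma minus_plus_cancel:
  fixes m u :: "'x lpm"
  assumes "\<And>x. Poly_Mapping.lookup u x \<le> Poly_Mapping.lookup m x"
  shows "(m - u) + u = m"
  by (rule poly_mapping_eqI) (simp add: lookup_add lookup_minus assms)

lemma lookup_pos_split: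
  fixes m :: "'x lpm"
  assumes "Poly_Mapping.lookup m x \<noteq> 0"
  obtains m' where "m = m' + Poly_Mapping.single x 1"
proof (rule that)
  show "m = (m - Poly_Mapping.single x 1) + Poly_Mapping.single x 1"
    by (rule minus_plus_cancel[symmetric]) (use assms in \<open>auto simp: lookup_single when_def\<close>)
qed

lemma colw_nth_split:
  assumes "k < length w"
  obtains m where "colw a w = m + Poly_Mapping.single (w ! k, a + k) 1"
  using lookup_pos_split[of "colw a w" "(w ! k, a + k)"] lookup_colw_nth[OF assms, of a] by auto

text \<open>The columns of the block end before those of \<open>t\<close> begin, so every letter of
  the block must come from \<open>colw a w\<close>. Hence \<open>w'\<close> is a contiguous factor
  of \<open>w\<close>, and cancelling it leaves the letters in front of it, those behind it and
  \<open>t\<close>.\<close>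

lemma colw_inside:
  assumes eq: "\<mu> + colw k w' = colw a w + t" and ne: "w' \<noteq> []"
    and t: "\<And>i j. j < a + length w \<Longrightarrow> Poly_Mapping.lookup t (i, j) = 0"
    and len: "k + length w' \<le> a + length w"
  obtains u1 u2 where "w = u1 @ w' @ u2" "k = a + length u1"
    "\<mu> = colw a u1 + colw (k + length w') u2 + t"
proof -
  have *: "a \<le> k + l \<and> w ! (k + l - a) = w' ! l" if "l < length w'" for l
  proof -
    have "1 \<le> Poly_Mapping.lookup (\<mu> + colw k w') (w' ! l, k + l)"
      using lookup_colw_nth[OF that, of k] by (simp add: lookup_add)
    then have "Poly_Mapping.lookup (colw a w) (w' ! l, k + l) \<noteq> 0"
      using t[of "k + l" "w' ! l"] that len by (simp add: eq lookup_add)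
    then show ?thesis
      by (auto simp: lookup_colw split: if_splits)
  qed
  from *[of 0] ne have ak: "a \<le> k"
    by simp
  define u1 u2 where "u1 = take (k - a) w" and "u2 = drop (k - a + length w') w"
  have "w' = take (length w') (drop (k - a) w)"
    using len ak * by (intro nth_equalityI) auto
  then have w: "w = u1 @ w' @ u2"
    unfolding u1_def u2_def by (metis append_take_drop_id drop_drop add.commute)
  have k: "k = a + length u1"
    using ak len by (simp add: u1_def)
  have "\<mu> + colw k w' = colw a u1 + colw (k + length w') u2 + t + colw k w'"
    unfolding eq by (simp add: w colw_append k add_ac)
  then show ?thesis
    using that w k by simp
qed

lemma colw_prefix:
  assumes "\<mu> + colw a w = colw a w'"
  obtains u where "w' = w @ u" "\<mu> = colw (a + length w) u"
proof (cases "w = []")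
  case True
  then show ?thesis
    using assms that[of w'] by simp
next
  case False
  have "length w \<le> length w'"
    using arg_cong[OF assms, of mdeg] by (simp add: mdeg_add)
  then show ?thesis
    using colw_inside[of \<mu> a w a w' 0] assms False that by auto
qed

lemma colw_inject: "colw a w = colw a w' \<longleftrightarrow> w = w'"
proof
  assume eq: "colw a w = colw a w'"
  then have "length w = length w'"
    by (metis mdeg_colw)
  moreover obtain u where "w' = w @ u"
    using colw_prefix[of 0 a w w'] eq by auto
  ultimately show "w = w'"
    by simp
qed auto

text \<open>\<open>w\<close> spells the longest run of columns from \<open>a\<close> on that occur in \<open>m\<close>, and these columns
  occur only once.\<close>
definition Dec :: "nat \<Rightarrow> 'x lpm \<Rightarrow> 'x list \<Rightarrow> 'x lpm \<Rightarrow> bool" where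
  "Dec a m w t \<longleftrightarrow> m = colw a w + t \<and> (\<forall>i j. j \<le> a + length w \<longrightarrow> Poly_Mapping.lookup t (i, j) = 0)"

text \<open>Up to and including the column \<open>a + length w\<close> no exponent comes from
  \<open>t\<close>, so the letters of \<open>w\<close> can be read off \<open>m\<close>, and the
  empty column behind them fixes the length.\<close>

lemma Dec_unique:
  assumes 1: "Dec a m w t" and 2: "Dec a m w' t'"
  shows "w = w'" "t = t'"
proof -
  \<comment> \<open>\<open>k\<close> may equal \<open>length w'\<close>, whose column is the gap
    behind \<open>w'\<close>. The conclusion \<open>k < length w'\<close> then shows that
    \<open>w\<close> cannot run past the end of \<open>w'\<close>.\<close>
  have nth: "k < length w' \<and> w ! k = w' ! k" if "Dec a m w t" "Dec a m w' t'" "k < length w" "k \<le> length w'"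
    for k w w' t t'
  proof -
    have "Poly_Mapping.lookup m (w ! k, a + k) \<ge> 1"
      using that(1,3) lookup_colw_nth[of k w a] by (auto simp: Dec_def lookup_add)
    then have "Poly_Mapping.lookup (colw a w') (w ! k, a + k) \<noteq> 0"
      using that(2,4) by (auto simp: Dec_def lookup_add)
    then show ?thesis
      by (auto simp: lookup_colw split: if_splits)
  qed
  have len: "length w = length w'"
    using nth[OF 1 2, of "length w'"] nth[OF 2 1, of "length w"] by (cases "length w" "length w'" rule: linorder_cases) auto
  show "w = w'"
    by (rule nth_equalityI[OF len]) (use nth[OF 1 2] len in auto)
  then show "t = t'"
    using 1 2 by (simp add: Dec_def)
qed

lemma Dec_colw: "Dec a (colw a w) w 0"
  by (simp add: Dec_def)

text \<open>Columns up to the gap do not occur in \<open>u\<close>, and \<open>colw a w\<close> has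
  none behind it, so all of \<open>u\<close> divides \<open>t\<close>.\<close>

lemma Dec_after:
  assumes eq: "\<mu> + u = colw a w + t"
    and u: "\<And>i j. j \<le> a + length w \<Longrightarrow> Poly_Mapping.lookup u (i, j) = 0"
  obtains t' where "t = t' + u" "\<mu> = colw a w + t'"
proof -
  have "Poly_Mapping.lookup u x \<le> Poly_Mapping.lookup t x" for x
  proof (cases x)
    case (Pair i j)
    show ?thesis
    proof (cases "j \<le> a + length w")
      case False
      then have "Poly_Mapping.lookup (colw a w) (i, j) = 0"
        by (simp add: lookup_colw)
      then have "Poly_Mapping.lookup (\<mu> + u) (i, j) = Poly_Mapping.lookup t (i, j)"
        by (simp only: eq lookup_add)
      then show ?thesis
        by (simp add: Pair lookup_add)
    qed (simp add: u Pair)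
  qed
  from minus_plus_cancel[OF this] have t: "t = (t - u) + u"
    by simp
  have "\<mu> + u = (colw a w + (t - u)) + u"
    unfolding eq by (subst t) (simp add: add_ac)
  then show ?thesis
    using that t by simp
qed

text \<open>A block of consecutive columns cannot cover the gap behind the run, so it lies either
  inside the run or entirely behind the gap. The case and the factors \<open>u1\<close>,
  \<open>u2\<close>, \<open>u\<close>, \<open>t\<close> do not depend on the letters of the block.
  This keeps the terms of a homogeneous element of \<open>I\<close> together.\<close>

lemma Dec_block_cases:
  assumes e: "e \<noteq> 0"
  obtains (none) "\<And>w u t. length w = e \<Longrightarrow> \<not> Dec a (\<mu> + colw k w) u t"
  | (inside) u1 u2 t where "\<And>w. length w = e \<Longrightarrow> Dec a (\<mu> + colw k w) (u1 @ w @ u2) t"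
  | (after) u t where "\<And>w. length w = e \<Longrightarrow> Dec a (\<mu> + colw k w) u (t + colw k w)"
proof (cases "\<exists>w u t. length w = e \<and> Dec a (\<mu> + colw k w) u t")
  case False
  then show ?thesis
    using none by blast
next
  case True
  then obtain w' w t where w': "length w' = e" and d: "Dec a (\<mu> + colw k w') w t"
    by blast
  then have eq: "\<mu> + colw k w' = colw a w + t"
    and t: "\<And>i j. j \<le> a + length w \<Longrightarrow> Poly_Mapping.lookup t (i, j) = 0"
    by (auto simp: Dec_def)
  consider "k + e \<le> a + length w" | "k \<le> a + length w" "a + length w < k + e" | "a + length w < k"
    by linarith
  then show ?thesis
  proof cases
    case 1
    obtain u1 u2 where w: "w = u1 @ w' @ u2" and k: "k = a + length u1"
      and \<mu>: "\<mu> = colw a u1 + colw (k + length w') u2 + t"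
      by (rule colw_inside[OF eq]) (use w' e t 1 in auto)
    have "Dec a (\<mu> + colw k v) (u1 @ v @ u2) t" if "length v = e" for v
      using that t by (simp add: Dec_def \<mu> colw_append k w' w add_ac)
    then show ?thesis
      using inside by blast
  next
    case 2
    \<comment> \<open>The block would cover the gap column \<open>a + length w\<close>, at its
      position \<open>l\<close>. But neither the run nor \<open>t\<close> has a letter
      there.\<close>
    define l where "l = a + length w - k"
    have l: "l < length w'" "k + l = a + length w"
      using 2 w' by (auto simp: l_def)
    have "1 \<le> Poly_Mapping.lookup (\<mu> + colw k w') (w' ! l, k + l)"
      using lookup_colw_nth[OF l(1), of k] by (simp add: lookup_add)
    then show ?thesis
      using t[of "k + l" "w' ! l"] l(2) by (simp add: eq lookup_add lookup_colw)
  next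
    case 3
    obtain t' where t': "t = t' + colw k w'" "\<mu> = colw a w + t'"
      by (rule Dec_after[OF eq]) (use 3 in \<open>auto simp: lookup_colw\<close>)
    have "Dec a (\<mu> + colw k v) w (t' + colw k v)" for v
      using t 3 by (auto simp: Dec_def t' add_ac lookup_add lookup_colw)
    then show ?thesis
      using after by blast
  qed
qed

text \<open>The exponent of a generator of \<open>Q\<close>; for \<open>i = k\<close> the generator
  is a square.\<close>

abbreviation dbl :: "'x \<Rightarrow> 'x \<Rightarrow> nat \<Rightarrow> 'x lpm" where
  "dbl i k j \<equiv> Poly_Mapping.single (i, j) 1 + Poly_Mapping.single (k, j) 1"

text \<open>Up to the gap every column of the monomial holds at most one letter, so the repeated
  column lies behind it.\<close>

lemma Dec_dbl:
  assumes "Dec a (\<mu> + dbl i k j) w t"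
  obtains t' where "t = t' + dbl i k j"
proof -
  have eq: "\<mu> + dbl i k j = colw a w + t"
    and t: "\<And>i j. j \<le> a + length w \<Longrightarrow> Poly_Mapping.lookup t (i, j) = 0"
    using assms by (auto simp: Dec_def)
  have "a + length w < j"
  proof (rule ccontr)
    assume "\<not> a + length w < j"
    then have lk: "Poly_Mapping.lookup (\<mu> + dbl i k j) (l, j) = Poly_Mapping.lookup (colw a w) (l, j)" for l
      by (simp only: eq lookup_add t not_less)
    have "Poly_Mapping.lookup (\<mu> + dbl i k j) (i, j) \<ge> (if i = k then 2 else 1)"
      "Poly_Mapping.lookup (\<mu> + dbl i k j) (k, j) \<ge> 1"
      by (auto simp: lookup_add lookup_single when_def)
    then show False
      unfolding lk by (auto simp: lookup_colw split: if_splits)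
  qed
  then show ?thesis
    using Dec_after[OF eq] that by (auto simp: lookup_add lookup_single when_def)
qed

text \<open>Take \<open>w\<close> as long as possible such that \<open>colw a w\<close> divides
  \<open>m\<close>. The cofactor then misses the next column, and if it meets a column of
  \<open>w\<close>, this column is repeated.\<close>

lemma Dec_exists:
  assumes low: "\<And>i j. j < a \<Longrightarrow> Poly_Mapping.lookup m (i, j) = 0"
  obtains (Dec) w t where "Dec a m w t" | (dbl) \<mu> i k j where "m = \<mu> + dbl i k j"
proof -
  define L where "L = {length w |w. \<exists>t. m = colw a w + t}"
  have "L \<subseteq> {..mdeg m}"
    by (auto simp: L_def mdeg_add)
  then have fin: "finite L"
    by (rule finite_subset) simp
  have "0 \<in> L"
    unfolding L_def by (auto intro!: exI[of _ "[]"])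
  then have "Max L \<in> L"
    using fin by (intro Max_in) auto
  then obtain w t where w: "length w = Max L" and m: "m = colw a w + t"
    unfolding L_def by force
  have top: "Poly_Mapping.lookup t (i, a + length w) = 0" for i
  proof (rule ccontr)
    assume "Poly_Mapping.lookup t (i, a + length w) \<noteq> 0"
    then obtain t' where "t = t' + Poly_Mapping.single (i, a + length w) 1"
      by (rule lookup_pos_split)
    then have "m = colw a (w @ [i]) + t'"
      by (simp add: m colw_append colw_single add_ac)
    then have "length (w @ [i]) \<in> L"
      unfolding L_def by blast
    then show False
      using Max_ge[OF fin] w by fastforce
  qed
  show ?thesis
  proof (cases "\<exists>i j. j \<le> a + length w \<and> Poly_Mapping.lookup t (i, j) \<noteq> 0")
    case False
    then show ?thesis
      using Dec m by (auto simp: Dec_def)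
  next
    case True
    then obtain i j where j: "j \<le> a + length w" and tij: "Poly_Mapping.lookup t (i, j) \<noteq> 0"
      by blast
    have "Poly_Mapping.lookup m (i, j) \<noteq> 0"
      using tij by (simp add: m lookup_add)
    then have "a \<le> j"
      using low[of j i] by (cases "j < a") auto
    moreover have "j \<noteq> a + length w"
      using top[of i] tij by auto
    ultimately obtain k where k: "k < length w" "j = a + k"
      using j that[of "j - a"] by linarith
    obtain t' where "t = t' + Poly_Mapping.single (i, j) 1"
      using tij by (rule lookup_pos_split)
    moreover obtain v where "colw a w = v + Poly_Mapping.single (w ! k, j) 1"
      using colw_nth_split[OF k(1), of a] k(2) by blast
    ultimately have "m = (v + t') + dbl i (w ! k) j"
      by (simp add: m add_ac)
    then show ?thesis
      by (rule dbl)
  qed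
qed

section \<open>The letterplace ideal\<close>

lemma pm_additive_induct [case_names zero single add]:
  fixes p :: "'a \<Rightarrow>\<^sub>0 'b::comm_monoid_add"
  assumes "P 0" "\<And>m c. P (Poly_Mapping.single m c)" "\<And>p q. P p \<Longrightarrow> P q \<Longrightarrow> P (p + q)"
  shows "P p"
proof -
  have "P (\<Sum>m\<in>X. Poly_Mapping.single m (Poly_Mapping.lookup p m))" for X
    by (induction X rule: infinite_finite_induct) (auto intro: assms)
  moreover have "(\<Sum>m\<in>Poly_Mapping.keys p. Poly_Mapping.single m (Poly_Mapping.lookup p m)) = p"
    by (rule poly_mapping_eqI) (auto simp: lookup_sum lookup_single when_def in_keys_iff sum.delta)
  ultimately show ?thesis
    by metis
qed

lemma sum_when_inj:
  assumes "finite X" "inj f"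
  shows "(\<Sum>w\<in>X. h w when f w = f v) = (if v \<in> X then h v else 0)"
proof -
  have "(\<Sum>w\<in>X. h w when f w = f v) = (\<Sum>w\<in>X. if w = v then h w else 0)"
    using assms(2) by (intro sum.cong) (auto simp: when_def inj_def)
  then show ?thesis
    using assms(1) by (simp add: sum.delta)
qed

text \<open>Closed form of \<open>(lpsigma ^^ a) (lpiota f)\<close>, see
  \<open>lpsigma_funpow_lpiota\<close>.\<close>

definition lpi :: "nat \<Rightarrow> ('x list \<Rightarrow> 'k::comm_ring_1) \<Rightarrow> ('x, 'k) lp" where
  "lpi a f = (\<Sum>w\<in>{w. f w \<noteq> 0}. Poly_Mapping.single (colw a w) (f w))"

lemma lookup_lpi_colw:
  assumes "f \<in> ncpoly"
  shows "Poly_Mapping.lookup (lpi a f) (colw a v) = f v"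
  using assms sum_when_inj[of "{w. f w \<noteq> 0}" "colw a" f v]
  by (auto simp: lpi_def lookup_sum lookup_single ncpoly_def inj_def colw_inject)

lemma lookup_lpi_other: "(\<And>w. m \<noteq> colw a w) \<Longrightarrow> Poly_Mapping.lookup (lpi a f) m = 0"
  by (simp add: lpi_def lookup_sum lookup_single when_def eq_commute[of "colw a _"])

lemma lpi_eqI:
  assumes "f \<in> ncpoly" "\<And>v. Poly_Mapping.lookup p (colw a v) = f v"
    and "\<And>m. (\<And>w. m \<noteq> colw a w) \<Longrightarrow> Poly_Mapping.lookup p m = 0"
  shows "lpi a f = p"
proof (rule poly_mapping_eqI)
  fix m
  show "Poly_Mapping.lookup (lpi a f) m = Poly_Mapping.lookup p m"
    by (cases "\<exists>w. m = colw a w") (use assms in \<open>auto simp: lookup_lpi_colw lookup_lpi_other\<close>)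
qed

lemma lpi_0 [simp]: "lpi a 0 = 0"
  by (simp add: lpi_def fun_at)

lemma lpi_add: "f \<in> ncpoly \<Longrightarrow> h \<in> ncpoly \<Longrightarrow> lpi a (f + h) = lpi a f + lpi a h"
  by (rule lpi_eqI) (auto simp: ncpoly_add lookup_add lookup_lpi_colw lookup_lpi_other fun_at)

lemma lpi_mono [simp]: "lpi a (ncmono w c) = Poly_Mapping.single (colw a w) c"
  by (rule lpi_eqI) (auto simp: lookup_single when_def ncmono_apply colw_inject)

lemma lpi_sum: "(\<And>x. x \<in> X \<Longrightarrow> f x \<in> ncpoly) \<Longrightarrow> lpi a (\<Sum>x\<in>X. f x) = (\<Sum>x\<in>X. lpi a (f x)) \<and> (\<Sum>x\<in>X. f x) \<in> ncpoly"
proof (induction X rule: infinite_finite_induct)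
  case (insert x X)
  then show ?case
    by (simp add: lpi_add ncpoly_add)
qed simp_all

lemma sum_keys_add:
  fixes \<theta> :: "'m \<Rightarrow> 'k::comm_ring_1 \<Rightarrow> 'b::comm_monoid_add"
  assumes "\<And>m c d. \<theta> m (c + d) = \<theta> m c + \<theta> m d" "\<And>m. \<theta> m 0 = 0"
  shows "(\<Sum>m\<in>Poly_Mapping.keys (p + q). \<theta> m (Poly_Mapping.lookup (p + q) m))
    = (\<Sum>m\<in>Poly_Mapping.keys p. \<theta> m (Poly_Mapping.lookup p m))
      + (\<Sum>m\<in>Poly_Mapping.keys q. \<theta> m (Poly_Mapping.lookup q m))"
  by (rule setsum_keys_plus_distrib) (use assms in auto)

lemma lpsigma_add: "lpsigma (p + q) = lpsigma p + lpsigma q"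
  unfolding lpsigma_def by (rule sum_keys_add) (auto simp: single_add)

lemma lpsigma_0: "lpsigma 0 = 0"
  by (simp add: lpsigma_def)

lemma lpsigma_single: "lpsigma (Poly_Mapping.single m c) = Poly_Mapping.single (mshift m) c"
  by (simp add: lpsigma_def)

lemma lpsigma_lpi: "f \<in> ncpoly \<Longrightarrow> lpsigma (lpi a f) = lpi (Suc a) f"
  by (induction f rule: ncpoly_induct)
    (simp_all add: lpsigma_0 lpsigma_single mshift_colw lpi_add lpsigma_add)

lemma lpiota_lpi: "lpiota f = lpi 0 f"
  by (simp add: lpiota_def lpi_def lpmono_colw)

lemma lpsigma_funpow_lpiota: "f \<in> ncpoly \<Longrightarrow> (lpsigma ^^ t) (lpiota f) = lpi t f"
  by (induction t) (simp_all add: lpsigma_lpi lpiota_lpi)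

text \<open>Words of length \<open>e\<close> placed from column \<open>a\<close> on end just before
  column \<open>a + e\<close>, so products of monomials are the monomials of the concatenated
  words.\<close>

lemma lpi_mult:
  assumes f: "f \<in> ncpoly" "nc_hom e f" and h: "h \<in> ncpoly"
  shows "lpi a f * lpi (a + e) h = lpi a (ncmult f h)"
  using h
proof (induction h rule: ncpoly_induct)
  case zero
  then show ?case by simp
next
  case (mono v c)
  have len: "length w = e" if "w \<in> {w. f w \<noteq> 0}" for w
    using that f(2) by (auto simp: nc_hom_def)
  have "lpi a (ncmult f (ncmono v c)) = lpi a (\<Sum>w\<in>{w. f w \<noteq> 0}. ncmono (w @ v) (f w * c))"
    by (subst ncpoly_expand[OF f(1)]) (simp add: ncmult_sum_left)
  also have "\<dots> = (\<Sum>w\<in>{w. f w \<noteq> 0}. Poly_Mapping.single (colw a (w @ v)) (f w * c))"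
    by (simp add: lpi_sum)
  also have "\<dots> = (\<Sum>w\<in>{w. f w \<noteq> 0}. Poly_Mapping.single (colw a w) (f w) * Poly_Mapping.single (colw (a + e) v) c)"
    by (rule sum.cong) (use len in \<open>auto simp: mult_single colw_append\<close>)
  also have "\<dots> = lpi a f * lpi (a + e) (ncmono v c)"
    by (simp add: lpi_def[of a f] sum_distrib_right)
  finally show ?case by simp
next
  case (add h k)
  then show ?case
    using f by (simp add: lpi_add distrib_left ncmult_add_right ncmult_ncpoly)
qed

text \<open>Represents the zero submodule of \<open>S^s\<close>, the counterpart of
  \<open>IV\<close>.\<close>

definition JV :: "nat \<Rightarrow> ('x list \<Rightarrow> 'k::comm_ring_1) set \<Rightarrow> (nat \<Rightarrow> ('x, 'k) lp) set" where
  "JV s I = {v \<in> lpvec s. \<forall>i. v i \<in> lpJ I}"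

section \<open>Induction principles for the letterplace ideal and its submodules\<close>

lemma lpJ_0: "0 \<in> lpJ I"
  and lpJ_add: "p \<in> lpJ I \<Longrightarrow> q \<in> lpJ I \<Longrightarrow> p + q \<in> lpJ I"
  and lpJ_mult: "p \<in> lpJ I \<Longrightarrow> c * p \<in> lpJ I"
  unfolding lpJ_def by (rule cideal.intros; assumption?)+

lemma lpJ_sum: "(\<And>x. x \<in> X \<Longrightarrow> f x \<in> lpJ I) \<Longrightarrow> (\<Sum>x\<in>X. f x) \<in> lpJ I"
  by (induction X rule: infinite_finite_induct) (auto intro: lpJ_0 lpJ_add)

lemma lpJ_dbl: "Poly_Mapping.single (\<mu> + dbl i k j) c \<in> lpJ I"
proof -
  have "lpvar i j * lpvar k j \<in> lpJ I"
    unfolding lpJ_def by (rule cideal.gen) blast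
  then have "Poly_Mapping.single \<mu> c * (lpvar i j * lpvar k j) \<in> lpJ I"
    by (rule lpJ_mult)
  then show ?thesis
    by (simp add: lpvar_def mult_single)
qed

lemma lpvec_add: "v \<in> lpvec s \<Longrightarrow> u \<in> lpvec s \<Longrightarrow> v + u \<in> lpvec s"
  by (simp add: lpvec_def fun_at)

lemma JV_add: "v \<in> JV s I \<Longrightarrow> u \<in> JV s I \<Longrightarrow> v + u \<in> JV s I"
  by (simp add: JV_def lpvec_add lpJ_add fun_at)

lemma JV_mult: "v \<in> JV s I \<Longrightarrow> (\<lambda>i. c * v i) \<in> JV s I"
  by (simp add: JV_def lpvec_def lpJ_mult)

lemma JV_0: "0 \<in> JV s I"
  by (simp add: JV_def lpvec_def lpJ_0 fun_at)

lemma JV_lp_sub: "v \<in> JV s I \<Longrightarrow> v \<in> lp_sub s (lpJ I) G"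
  by (simp add: JV_def lp_sub.ideal)

lemma JV_sum: "(\<And>x. x \<in> X \<Longrightarrow> f x \<in> JV s I) \<Longrightarrow> (\<Sum>x\<in>X. f x) \<in> JV s I"
  by (induction X rule: infinite_finite_induct) (auto intro: JV_0 JV_add)

lemma lp_sub_0: "0 \<in> lp_sub s (lpJ I) G"
  by (rule JV_lp_sub[OF JV_0])

lemma lp_sub_sum: "(\<And>x. x \<in> X \<Longrightarrow> f x \<in> lp_sub s (lpJ I) G) \<Longrightarrow> (\<Sum>x\<in>X. f x) \<in> lp_sub s (lpJ I) G"
  by (induction X rule: infinite_finite_induct) (auto intro: lp_sub_0 lp_sub.add)

lemma lp_sub_uminus:
  assumes "v \<in> lp_sub s J G"
  shows "- v \<in> lp_sub s J G"
  using lp_sub.smult[OF assms, of "-1"] by (simp add: fun_Compl_def)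

lemma lp_sub_subset: "v \<in> lp_sub s J G \<Longrightarrow> G \<subseteq> lp_sub s J H \<Longrightarrow> v \<in> lp_sub s J H"
proof (induction rule: lp_sub.induct)
  case (gen v)
  then show ?case by blast
next
  case (ideal v)
  then show ?case by (simp add: lp_sub.ideal)
next
  case (add v u)
  then show ?case by (simp add: lp_sub.add)
next
  case (smult v c)
  then show ?case by (simp add: lp_sub.smult)
qed

text \<open>Serves maps that are additive but not \<open>S\<close>-linear, like
  \<open>nc_rsub_additive_induct\<close> over the free algebra. Quantifying over all multiples
  \<open>c * v\<close> settles the case of \<open>smult\<close>, and every multiplier of a generator
  is a sum of terms.\<close>

lemma lp_sub_additive_induct [consumes 1, case_names ideal add single]:
  assumes v: "v \<in> lp_sub s (lpJ I) G"
    and ideal: "\<And>v. v \<in> JV s I \<Longrightarrow> P v"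
    and add: "\<And>v u. P v \<Longrightarrow> P u \<Longrightarrow> P (v + u)"
    and single: "\<And>b m c. b \<in> G \<Longrightarrow> P (\<lambda>i. Poly_Mapping.single m c * b i)"
  shows "P v"
proof -
  have "\<forall>c. P (\<lambda>i. c * v i)"
    using v
  proof induction
    case (gen b)
    show ?case
    proof
      fix c
      show "P (\<lambda>i. c * b i)"
      proof (induction c rule: pm_additive_induct)
        case zero
        then show ?case
          using ideal[OF JV_0] by (simp add: zero_fun_def)
      next
        case (single m c)
        then show ?case
          by (rule assms(4)[OF gen])
      next
        case (add p q)
        from assms(3)[OF this] show ?case
          by (simp add: plus_fun_def distrib_right)
      qed
    qed
  next
    case (ideal v)
    then have "v \<in> JV s I"
      by (simp add: JV_def)
    then show ?case
      by (blast intro: JV_mult assms(2))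
  next
    case (add v u)
    show ?case
    proof
      fix c
      have "P ((\<lambda>i. c * v i) + (\<lambda>i. c * u i))"
        using add by (blast intro: assms(3))
      then show "P (\<lambda>i. c * (v + u) i)"
        by (simp add: plus_fun_def distrib_left)
    qed
  next
    case (smult v c)
    show ?case
    proof
      fix d
      show "P (\<lambda>i. d * (c * v i))"
        using smult(2)[rule_format, of "d * c"] by (simp add: mult.assoc)
    qed
  qed
  from this[rule_format, of 1] show ?thesis
    by simp
qed

lemma lpJ_lpi:
  fixes I :: "('x list \<Rightarrow> 'k::field) set"
  assumes I: "nc_graded_ideal I" and f: "f \<in> I"
  shows "lpi t f \<in> lpJ I"
proof -
  have "(lpsigma ^^ t) (lpiota f) \<in> lpJ I"
    unfolding lpJ_def by (rule cideal.gen) (use f in blast)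
  then show ?thesis
    by (simp add: lpsigma_funpow_lpiota ideal_ncpoly[OF I f])
qed

text \<open>By gradedness, shifts of homogeneous elements of \<open>I\<close> suffice to generate
  \<open>J\<close>, and multipliers can be split into terms. What remains are blocks of fixed length
  in fixed columns and multiples of the generators of \<open>Q\<close>.\<close>

lemma lpJ_additive_induct [consumes 2, case_names dbl block add]:
  fixes I :: "('x list \<Rightarrow> 'k::field) set"
  assumes I: "nc_graded_ideal I" and p: "p \<in> lpJ I"
    and dbl: "\<And>\<mu> i k j c. P (Poly_Mapping.single (\<mu> + dbl i k j) c)"
    and block: "\<And>\<mu> e t f. f \<in> I \<Longrightarrow> nc_hom e f \<Longrightarrow> P (Poly_Mapping.single \<mu> 1 * lpi t f)"
    and add: "\<And>p q. P p \<Longrightarrow> P q \<Longrightarrow> P (p + q)"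
  shows "P p"
proof -
  have P0: "P 0"
    using dbl[of 0 undefined undefined undefined 0] by simp
  have "\<forall>q. P (q * p)"
    using p unfolding lpJ_def
  proof induction
    case (gen g)
    show ?case
    proof
      fix q
      from gen consider i k j where "g = lpvar i j * lpvar k j"
        | t f where "f \<in> I" "g = lpi t f"
        using lpsigma_funpow_lpiota ideal_ncpoly[OF I] by blast
      then show "P (q * g)"
      proof cases
        case 1
        show ?thesis
        proof (induction q rule: pm_additive_induct)
          case (single m c)
          show ?case
            using dbl[of m] by (simp add: 1 lpvar_def mult_single)
        qed (auto simp: P0 distrib_right intro: add)
      next
        case 2
        show ?thesis
          using I 2(1) unfolding 2(2)
        proof (induction f rule: ideal_hom_induct)
          case (hom e f)
          show ?case
          proof (induction q rule: pm_additive_induct)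
            case (single m c)
            \<comment> \<open>The coefficient \<open>c\<close> is absorbed into \<open>f\<close>,
              since \<open>I\<close> is closed under scalars; the multiplier in \<open>block\<close>
              can thus be monic.\<close>
            let ?f = "ncmult (ncmono [] c) f"
            have f: "?f \<in> I"
              by (rule ideal_left[OF I hom(1)]) simp
            have "lpi t ?f = Poly_Mapping.single 0 c * lpi t f"
              using lpi_mult[of "ncmono [] c" 0 f t] ideal_ncpoly[OF I hom(1)]
              by (simp add: nc_hom_def ncmono_apply)
            then have "Poly_Mapping.single m c * lpi t f = Poly_Mapping.single m 1 * lpi t ?f"
              by (simp only: mult.assoc[symmetric] mult_single) simp
            moreover have "nc_hom e ?f"
              using hom(2) by (auto simp: nc_hom_def ncmult_scalar_left)
            ultimately show ?case
              using block[OF f] by simp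
          qed (auto simp: P0 distrib_right intro: add)
        next
          case (add f h)
          then show ?case
            using ideal_ncpoly[OF I] by (auto simp: lpi_add distrib_left intro: assms(5))
        qed
      qed
    qed
  next
    case zero
    then show ?case by (simp add: P0)
  next
    case (add a b)
    then show ?case by (simp add: distrib_left assms(5))
  next
    case (mult a c)
    then show ?case by (metis mult.assoc)
  qed
  from this[rule_format, of 1] show ?thesis
    by simp
qed

lemma lpJ_UNIV:
  fixes I :: "('x list \<Rightarrow> 'k::field) set"
  assumes "nc_graded_ideal I" "I = ncpoly"
  shows "p \<in> lpJ I"
proof -
  have "lpi 0 (ncmono [] 1) \<in> lpJ I"
    by (rule lpJ_lpi) (use assms in simp_all)
  from lpJ_mult[OF this, of p] show ?thesis
    by simp
qed

section \<open>Uniqueness of the numbers of minimal generators\<close>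

context vector_space
begin

lemma span_mapsto_subspace:
  assumes W: "subspace W" and "v \<in> span X" "\<And>x. x \<in> X \<Longrightarrow> T x \<in> W"
    and T: "\<And>u v. T (u + v) = T u + T v" "\<And>c v. T (scale c v) = scale c (T v)"
  shows "T v \<in> W"
proof -
  have "T 0 = 0"
    using T(2)[of 0 0] by simp
  then have "subspace {v. T v \<in> W}"
    using W by (auto simp: subspace_def T)
  then show ?thesis
    using assms(2,3) span_minimal[of X "{v. T v \<in> W}"] by blast
qed

text \<open>The exchange lemma in the quotient by \<open>span U\<close>, without forming the
  quotient. For finite \<open>Z \<subseteq> X\<close>, a basis of \<open>span U\<close> together
  with \<open>Z\<close> is independent; the linear map that kills this basis and fixes
  \<open>Z\<close> maps \<open>span (U \<union> Y)\<close> into the span of at most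
  \<open>card Y\<close> vectors.\<close>

lemma card_le_modulo:
  assumes ind: "\<And>x. x \<in> X \<Longrightarrow> x \<notin> span (U \<union> (X - {x}))"
    and span: "X \<subseteq> span (U \<union> Y)" and fin: "finite Y"
  shows "finite X \<and> card X \<le> card Y"
proof -
  obtain B where B: "B \<subseteq> U" "independent B" "U \<subseteq> span B"
    by (rule maximal_independent_subset)
  \<comment> \<open>\<open>X\<close> is not known to be finite; a uniform bound on its finite
    subsets yields this too.\<close>
  have "card Z \<le> card Y" if Z: "Z \<subseteq> X" "finite Z" for Z
  proof -
    have "independent (B \<union> Z)"
      using Z(2,1)
    proof (induction Z)
      case (insert z Z)
      then have "B \<union> Z \<subseteq> U \<union> (X - {z})"
        using B(1) by blast
      then have "z \<notin> span (B \<union> Z)"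
        using ind[of z] insert.prems span_mono by blast
      then show ?case
        using insert independent_insertI[of z "B \<union> Z"] by simp
    qed (use B in simp)
    interpret vector_space_pair scale scale ..
    let ?f = "construct (B \<union> Z) (\<lambda>b. if b \<in> Z then b else 0)"
    interpret f: linear scale scale ?f
      by (rule linear_construct) fact
    have fZ: "?f z = z" if "z \<in> Z" for z
      using that construct_basis[OF \<open>independent (B \<union> Z)\<close>, of z] by auto
    have "?f b = 0" if "b \<in> B" for b
    proof -
      have "b \<notin> Z"
        using that B(1) ind[of b] Z(1) span_base[of b "U \<union> (X - {b})"] by blast
      then show ?thesis
        using that construct_basis[OF \<open>independent (B \<union> Z)\<close>, of b] by simp
    qed
    then have fU: "?f u = 0" if "u \<in> U" for u
      using that B(3) f.eq_0_on_span by blast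
    have "Z = ?f ` Z"
      using fZ by force
    also have "\<dots> \<subseteq> ?f ` span (U \<union> Y)"
      using Z span by blast
    also have "\<dots> = span (?f ` (U \<union> Y))"
      by (simp only: f.span_image)
    also have "\<dots> \<subseteq> span (insert 0 (?f ` Y))"
      by (rule span_mono) (use fU in auto)
    also have "\<dots> = span (?f ` Y)"
      by simp
    finally have "Z \<subseteq> span (?f ` Y)" .
    moreover have "independent Z"
      by (rule independent_mono[OF \<open>independent (B \<union> Z)\<close>]) blast
    ultimately have "card Z \<le> card (?f ` Y)"
      using independent_span_bound fin by blast
    also have "\<dots> \<le> card Y"
      using fin by (rule card_image_le)
    finally show ?thesis .
  qed
  then show ?thesis
    using finite_if_finite_subsets_card_bdd[of X "card Y"] by blast
qed

end

section \<open>Restriction of polynomials to a set of monomials\<close>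

definition pfilter :: "('m \<Rightarrow> bool) \<Rightarrow> ('m \<Rightarrow>\<^sub>0 'k::zero) \<Rightarrow> ('m \<Rightarrow>\<^sub>0 'k)" where
  "pfilter P p = Poly_Mapping.mapp (\<lambda>m c. c when P m) p"

lemma lookup_pfilter: "Poly_Mapping.lookup (pfilter P p) m = (if P m then Poly_Mapping.lookup p m else 0)"
  by (simp add: pfilter_def lookup_mapp when_def in_keys_iff)

lemma pfilter_add: "pfilter P (p + q) = pfilter P p + pfilter P q"
  for p q :: "'m \<Rightarrow>\<^sub>0 'k::monoid_add"
  by (rule poly_mapping_eqI) (simp add: lookup_pfilter lookup_add)

lemma pfilter_all: "(\<And>m. m \<in> Poly_Mapping.keys p \<Longrightarrow> P m) \<Longrightarrow> pfilter P p = p"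
  by (rule poly_mapping_eqI) (auto simp: lookup_pfilter in_keys_iff)

lemma pfilter_none: "(\<And>m. m \<in> Poly_Mapping.keys p \<Longrightarrow> \<not> P m) \<Longrightarrow> pfilter P p = 0"
  by (rule poly_mapping_eqI) (auto simp: lookup_pfilter in_keys_iff)

lemma pfilter_single: "pfilter P (Poly_Mapping.single m c) = (if P m then Poly_Mapping.single m c else 0)"
  by (rule poly_mapping_eqI) (auto simp: lookup_pfilter lookup_single when_def)

lemma lookup_scalar: "Poly_Mapping.lookup (Poly_Mapping.single 0 c * p) m = c * Poly_Mapping.lookup p m"
  for p :: "('a::cancel_comm_monoid_add) \<Rightarrow>\<^sub>0 'k::comm_ring_1"
  by (induction p rule: pm_additive_induct)
    (simp_all add: mult_single lookup_single when_def distrib_left lookup_add)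

lemma pfilter_scalar: "pfilter P (Poly_Mapping.single 0 c * p) = Poly_Mapping.single 0 c * pfilter P p"
  for p :: "('a::cancel_comm_monoid_add) \<Rightarrow>\<^sub>0 'k::comm_ring_1"
  by (rule poly_mapping_eqI) (simp add: lookup_pfilter lookup_scalar)

lemma keys_single_mult: "Poly_Mapping.keys (Poly_Mapping.single \<mu> c * p) \<subseteq> (+) \<mu> ` Poly_Mapping.keys p"
  for p :: "('a::cancel_comm_monoid_add) \<Rightarrow>\<^sub>0 'k::comm_ring_1"
  using keys_mult[of "Poly_Mapping.single \<mu> c" p] by (force split: if_splits)

lemma keys_lpi: "Poly_Mapping.keys (lpi a f) \<subseteq> colw a ` {w. f w \<noteq> 0}"
proof
  fix m
  assume "m \<in> Poly_Mapping.keys (lpi a f)"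
  then have "\<exists>w\<in>{w. f w \<noteq> 0}. m \<in> Poly_Mapping.keys (Poly_Mapping.single (colw a w) (f w))"
    unfolding lpi_def using keys_sum by fastforce
  then show "m \<in> colw a ` {w. f w \<noteq> 0}"
    by (auto split: if_splits)
qed

text \<open>\<open>P\<close> cannot tell words of equal length in the same block apart, so it keeps
  or drops \<open>\<mu> \<sigma>\<^sup>t (\<iota> f)\<close> as a whole when \<open>f\<close> is
  homogeneous. The generators of \<open>Q\<close> are single monomials.\<close>

lemma pfilter_lpJ:
  fixes I :: "('x list \<Rightarrow> 'k::field) set"
  assumes I: "nc_graded_ideal I" and p: "p \<in> lpJ I"
    and P: "\<And>\<mu> t w w'. length w = length w' \<Longrightarrow> P (\<mu> + colw t w) \<longleftrightarrow> P (\<mu> + colw t w')"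
  shows "pfilter P p \<in> lpJ I"
  using I p
proof (induction p rule: lpJ_additive_induct)
  case (dbl \<mu> i k j c)
  show ?case
    unfolding pfilter_single by (simp only: lpJ_dbl lpJ_0 split: if_split) simp
next
  case (block \<mu> e t f)
  have keys: "\<exists>w. length w = e \<and> m = \<mu> + colw t w"
    if "m \<in> Poly_Mapping.keys (Poly_Mapping.single \<mu> 1 * lpi t f)" for m
    using that keys_single_mult[of \<mu> 1 "lpi t f"] keys_lpi[of t f] block(2) by (fastforce simp: nc_hom_def)
  show ?case
  proof (cases "\<exists>w. length w = e \<and> P (\<mu> + colw t w)")
    case True
    then have "pfilter P (Poly_Mapping.single \<mu> 1 * lpi t f) = Poly_Mapping.single \<mu> 1 * lpi t f"
      using keys P by (intro pfilter_all) metis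
    then show ?thesis
      using lpJ_mult[OF lpJ_lpi[OF I block(1)]] by simp
  next
    case False
    then have "pfilter P (Poly_Mapping.single \<mu> 1 * lpi t f) = 0"
      using keys by (intro pfilter_none) metis
    then show ?thesis
      by (simp add: lpJ_0)
  qed
next
  case (add p q)
  then show ?case by (simp add: pfilter_add lpJ_add)
qed

section \<open>Homogeneous components and a graded Nakayama argument\<close>

definition lp_comp :: "(nat \<Rightarrow> nat) \<Rightarrow> nat \<Rightarrow> (nat \<Rightarrow> ('x, 'k::comm_ring_1) lp) \<Rightarrow> nat \<Rightarrow> ('x, 'k) lp" where
  "lp_comp \<delta> d v = (\<lambda>i. pfilter (\<lambda>m. mdeg m + \<delta> i = d) (v i))"

lemma lp_comp_add: "lp_comp \<delta> d (u + v) = lp_comp \<delta> d u + lp_comp \<delta> d v"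
  by (simp add: lp_comp_def fun_eq_iff fun_at pfilter_add)

lemma lp_comp_hom: "lp_vhom \<delta> d v \<Longrightarrow> lp_comp \<delta> d v = v"
  by (auto simp: lp_comp_def lp_vhom_def fun_eq_iff intro!: pfilter_all)

lemma lp_comp_other: "lp_vhom \<delta> d' v \<Longrightarrow> d \<noteq> d' \<Longrightarrow> lp_comp \<delta> d v = 0"
  by (auto simp: lp_comp_def lp_vhom_def fun_eq_iff fun_at intro!: pfilter_none)

lemma lp_comp_JV:
  fixes I :: "('x list \<Rightarrow> 'k::field) set"
  assumes I: "nc_graded_ideal I" and v: "v \<in> JV s I"
  shows "lp_comp \<delta> d v \<in> JV s I"
proof -
  have "pfilter (\<lambda>m. mdeg m + \<delta> i = d) (v i) \<in> lpJ I" for i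
    by (rule pfilter_lpJ[OF I]) (use v in \<open>auto simp: JV_def mdeg_add\<close>)
  then show ?thesis
    using v by (auto simp: JV_def lpvec_def lp_comp_def intro!: pfilter_none)
qed

lemma lp_vhom_single_mult:
  assumes "lp_vhom \<delta> d v"
  shows "lp_vhom \<delta> (mdeg \<mu> + d) (\<lambda>i. Poly_Mapping.single \<mu> c * v i)"
  unfolding lp_vhom_def
proof (intro allI ballI)
  fix i m
  assume "m \<in> Poly_Mapping.keys (Poly_Mapping.single \<mu> c * v i)"
  then obtain m' where "m' \<in> Poly_Mapping.keys (v i)" "m = \<mu> + m'"
    using keys_single_mult by blast
  then show "mdeg m + \<delta> i = mdeg \<mu> + d"
    using assms by (auto simp: lp_vhom_def mdeg_add)
qed

definition lpscale :: "'k::comm_ring_1 \<Rightarrow> (nat \<Rightarrow> ('x, 'k) lp) \<Rightarrow> (nat \<Rightarrow> ('x, 'k) lp)" where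
  "lpscale c v = (\<lambda>i. Poly_Mapping.single 0 c * v i)"

interpretation lpv: vector_space "lpscale :: 'k::field \<Rightarrow> (nat \<Rightarrow> ('x, 'k) lp) \<Rightarrow> _"
proof
  fix a b :: 'k and u v :: "nat \<Rightarrow> ('x, 'k) lp"
  show "lpscale a (u + v) = lpscale a u + lpscale a v"
    by (simp add: lpscale_def fun_eq_iff fun_at distrib_left)
  show "lpscale (a + b) v = lpscale a v + lpscale b v"
    by (simp add: lpscale_def fun_eq_iff fun_at single_add distrib_right)
  show "lpscale a (lpscale b v) = lpscale (a * b) v"
    by (simp add: lpscale_def fun_eq_iff mult.assoc[symmetric] mult_single)
  show "lpscale 1 v = v"
    by (simp add: lpscale_def)
qed

lemma lp_comp_scale: "lp_comp \<delta> d (lpscale c v) = lpscale c (lp_comp \<delta> d v)"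
  by (simp add: lp_comp_def lpscale_def pfilter_scalar)

lemma subspace_lp_sub: "lpv.subspace (lp_sub s (lpJ I) G)"
  by (rule lpv.subspaceI) (auto simp: lpscale_def intro: lp_sub_0 lp_sub.add lp_sub.smult)

text \<open>The span of \<open>aug s I G\<close> is the preimage of \<open>N \<mm>\<close>, where \<open>N\<close> is generated by \<open>G\<close> and
  \<open>\<mm>\<close> is the ideal of the elements of positive degree.\<close>
definition aug :: "nat \<Rightarrow> ('x list \<Rightarrow> 'k::comm_ring_1) set \<Rightarrow> (nat \<Rightarrow> ('x, 'k) lp) set \<Rightarrow> (nat \<Rightarrow> ('x, 'k) lp) set" where
  "aug s I G = JV s I \<union> {\<lambda>i. Poly_Mapping.single m c * b i | m c b. m \<noteq> 0 \<and> b \<in> G}"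

lemma aug_JV: "v \<in> JV s I \<Longrightarrow> v \<in> aug s I G"
  by (simp add: aug_def)

lemma aug_single: "m \<noteq> 0 \<Longrightarrow> b \<in> G \<Longrightarrow> (\<lambda>i. Poly_Mapping.single m c * b i) \<in> aug s I G"
  unfolding aug_def by blast

lemma single_mult_in_span_aug:
  fixes I :: "('x list \<Rightarrow> 'k::field) set"
  assumes "v \<in> lp_sub s (lpJ I) G" and \<mu>: "\<mu> \<noteq> 0"
  shows "(\<lambda>i. Poly_Mapping.single \<mu> c * v i) \<in> lpv.span (aug s I G)"
  using assms(1)
proof (induction v rule: lp_sub_additive_induct)
  case (ideal v)
  then show ?case
    by (intro lpv.span_base aug_JV JV_mult)
next
  case (add v u)
  then show ?case
    using lpv.span_add by (fastforce simp: plus_fun_def distrib_left)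
next
  case (single b m d)
  have "(\<lambda>i. Poly_Mapping.single (\<mu> + m) (c * d) * b i) \<in> lpv.span (aug s I G)"
    using \<mu> single by (intro lpv.span_base aug_single) (auto simp: lpm_add_eq_0)
  then show ?case
    by (simp add: mult.assoc[symmetric] mult_single)
qed

text \<open>A multiple of an element of \<open>N\<close> by a nontrivial monomial is, modulo
  \<open>J\<close>, a combination of such multiples of the generators. So \<open>N \<mm>\<close>
  depends on \<open>N\<close> only and can be computed from any generators.\<close>

lemma span_aug_lp_sub:
  fixes I :: "('x list \<Rightarrow> 'k::field) set"
  shows "lpv.span (aug s I (lp_sub s (lpJ I) G)) = lpv.span (aug s I G)"
proof
  show "lpv.span (aug s I (lp_sub s (lpJ I) G)) \<subseteq> lpv.span (aug s I G)"
    using single_mult_in_span_aug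
    by (intro lpv.span_minimal lpv.subspace_span) (auto simp: aug_def intro: lpv.span_base)
  show "lpv.span (aug s I G) \<subseteq> lpv.span (aug s I (lp_sub s (lpJ I) G))"
    by (rule lpv.span_mono) (auto simp: aug_def intro: lp_sub.gen)
qed

text \<open>Multipliers of generators split into constants, which give the span of \<open>G\<close>,
  and terms of positive degree, which give \<open>aug\<close>.\<close>

lemma lp_sub_in_span:
  fixes I :: "('x list \<Rightarrow> 'k::field) set"
  assumes "v \<in> lp_sub s (lpJ I) G"
  shows "v \<in> lpv.span (aug s I G \<union> G)"
  using assms
proof (induction v rule: lp_sub_additive_induct)
  case (ideal v)
  then show ?case by (simp add: lpv.span_base aug_JV)
next
  case (add v u)
  then show ?case by (rule lpv.span_add)
next
  case (single b m c)
  show ?case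
  proof (cases "m = 0")
    case True
    then show ?thesis
      using lpv.span_scale[OF lpv.span_base, of b "aug s I G \<union> G" c] single by (simp add: lpscale_def[of c b])
  next
    case False
    then show ?thesis
      using single by (intro lpv.span_base) (simp add: aug_single)
  qed
qed

text \<open>The projection to degree \<open>d\<close> preserves \<open>JV\<close> and keeps or kills
  each of the other spanning vectors, since these are homogeneous.\<close>

lemma lp_hom_in_span:
  fixes I :: "('x list \<Rightarrow> 'k::field) set"
  assumes I: "nc_graded_ideal I" and G: "\<And>b. b \<in> G \<Longrightarrow> \<exists>d. lp_vhom \<delta> d b"
    and v: "v \<in> lp_sub s (lpJ I) G" "lp_vhom \<delta> d v"
  shows "v \<in> lpv.span (aug s I G \<union> {b \<in> G. lp_vhom \<delta> d b})"
proof -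
  let ?W = "lpv.span (aug s I G \<union> {b \<in> G. lp_vhom \<delta> d b})"
  have "lp_comp \<delta> d x \<in> ?W" if "x \<in> aug s I G \<union> G" for x
  proof -
    consider "x \<in> JV s I" | m c b where "m \<noteq> 0" "b \<in> G" "x = (\<lambda>i. Poly_Mapping.single m c * b i)" | "x \<in> G"
      using \<open>x \<in> _\<close> unfolding aug_def by blast
    then show ?thesis
    proof cases
      case 1
      then show ?thesis
        using lp_comp_JV[OF I] by (intro lpv.span_base UnI1 aug_JV)
    next
      case 2
      then obtain e where "lp_vhom \<delta> e x"
        using G lp_vhom_single_mult by blast
      moreover have "x \<in> ?W"
        using 2 by (intro lpv.span_base) (simp add: aug_single)
      ultimately show ?thesis
        by (cases "e = d") (auto simp: lp_comp_hom lp_comp_other lpv.span_zero)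
    next
      case 3
      then obtain e where "lp_vhom \<delta> e x"
        using G by blast
      then show ?thesis
        using 3 by (cases "e = d") (auto simp: lp_comp_hom lp_comp_other lpv.span_zero intro: lpv.span_base)
    qed
  qed
  then have "lp_comp \<delta> d v \<in> ?W"
    by (rule lpv.span_mapsto_subspace[OF lpv.subspace_span lp_sub_in_span[OF v(1)],
          where T = "lp_comp \<delta> d", OF _ lp_comp_add lp_comp_scale])
  then show ?thesis
    using v(2) by (simp add: lp_comp_hom)
qed

text \<open>In the degree of \<open>b\<close>, only generators of smaller degree contribute to
  \<open>N \<mm>\<close>, and \<open>b\<close> is none of them; so a linear dependence modulo
  \<open>N \<mm>\<close> would express \<open>b\<close> by the other generators. This is a form of
  Nakayama's lemma for graded modules.\<close>

lemma lp_minbasis_not_in_span: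
  fixes I :: "('x list \<Rightarrow> 'k::field) set"
  assumes I: "nc_graded_ideal I" and B: "lp_minbasis s (lpJ I) \<delta> N B" and b: "b \<in> B"
  shows "b \<notin> lpv.span (aug s I B \<union> (B - {b}))"
proof
  let ?W = "lp_sub s (lpJ I) (B - {b})"
  assume asm: "b \<in> lpv.span (aug s I B \<union> (B - {b}))"
  obtain d where d: "lp_vhom \<delta> d b"
    using B b by (auto simp: lp_minbasis_def)
  have bW: "b \<notin> ?W"
    using B b by (auto simp: lp_minbasis_def)
  have "lp_comp \<delta> d x \<in> ?W" if "x \<in> aug s I B \<union> (B - {b})" for x
  proof -
    consider "x \<in> JV s I" | m c b' where "m \<noteq> 0" "b' \<in> B" "x = (\<lambda>i. Poly_Mapping.single m c * b' i)"
      | "x \<in> B - {b}"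
      using \<open>x \<in> _\<close> unfolding aug_def by blast
    then show ?thesis
    proof cases
      case 1
      then show ?thesis
        using lp_comp_JV[OF I] by (intro JV_lp_sub)
    next
      case 2
      then obtain e where e: "lp_vhom \<delta> e b'"
        using B unfolding lp_minbasis_def by blast
      then have x: "lp_vhom \<delta> (mdeg m + e) x"
        using 2(3) lp_vhom_single_mult by blast
      show ?thesis
      proof (cases "mdeg m + e = d")
        case True
        \<comment> \<open>\<open>b'\<close> has degree below \<open>d\<close>, whereas
          \<open>b\<close> equals its own component of degree \<open>d\<close> and is nonzero, as 0
          lies in \<open>?W\<close>.\<close>
        then have "lp_comp \<delta> d b' = 0"
          using lp_comp_other[OF e, of d] 2(1) mdeg_eq_0[of m] by linarith
        then have "b' \<noteq> b"
          using lp_comp_hom[OF d] bW lp_sub_0 by metis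
        then have "x \<in> ?W"
          using 2 by (simp add: lp_sub.smult lp_sub.gen)
        then show ?thesis
          using x True by (simp add: lp_comp_hom)
      next
        case False
        then show ?thesis
          using lp_comp_other[OF x] by (simp add: lp_sub_0)
      qed
    next
      case 3
      then obtain e where "lp_vhom \<delta> e x"
        using B unfolding lp_minbasis_def by blast
      then show ?thesis
        using 3 by (cases "e = d") (auto simp: lp_comp_hom lp_comp_other lp_sub_0 intro: lp_sub.gen)
    qed
  qed
  then have "lp_comp \<delta> d b \<in> ?W"
    by (rule lpv.span_mapsto_subspace[OF subspace_lp_sub asm, where T = "lp_comp \<delta> d",
          OF _ lp_comp_add lp_comp_scale])
  then show False
    using d bW by (simp add: lp_comp_hom)
qed

text \<open>The elements of degree \<open>d\<close> of a minimal basis of \<open>N\<close> are independent modulo \<open>N \<mm>\<close>, which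
  does not depend on the basis.\<close>
lemma lp_minbasis_card_le:
  fixes I :: "('x list \<Rightarrow> 'k::field) set"
  assumes I: "nc_graded_ideal I" and B: "lp_minbasis s (lpJ I) \<delta> N B"
    and G: "lp_sub s (lpJ I) G = N" "\<And>b. b \<in> G \<Longrightarrow> \<exists>d. lp_vhom \<delta> d b"
    and fin: "finite {b \<in> G. lp_vhom \<delta> d b}"
  shows "finite {b \<in> B. lp_vhom \<delta> d b} \<and> card {b \<in> B. lp_vhom \<delta> d b} \<le> card {b \<in> G. lp_vhom \<delta> d b}"
proof (rule lpv.card_le_modulo[OF _ _ fin])
  have N: "lp_sub s (lpJ I) B = N"
    using B by (simp add: lp_minbasis_def)
  have aug: "lpv.span (aug s I B) = lpv.span (aug s I G)"
    using span_aug_lp_sub[of s I B] span_aug_lp_sub[of s I G] by (simp add: N G(1))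
  show "{b \<in> B. lp_vhom \<delta> d b} \<subseteq> lpv.span (aug s I G \<union> {b \<in> G. lp_vhom \<delta> d b})"
  proof
    fix b
    assume "b \<in> {b \<in> B. lp_vhom \<delta> d b}"
    then show "b \<in> lpv.span (aug s I G \<union> {b \<in> G. lp_vhom \<delta> d b})"
      using N G(1) by (intro lp_hom_in_span[OF I G(2)]) (auto intro: lp_sub.gen)
  qed
  fix b
  assume "b \<in> {b \<in> B. lp_vhom \<delta> d b}"
  then have "b \<notin> lpv.span (aug s I B \<union> (B - {b}))"
    using lp_minbasis_not_in_span[OF I B] by blast
  moreover have "aug s I G \<union> ({b \<in> B. lp_vhom \<delta> d b} - {b}) \<subseteq> lpv.span (aug s I B \<union> (B - {b}))"
    using lpv.span_superset[of "aug s I G"] lpv.span_mono[of "aug s I B" "aug s I B \<union> (B - {b})"]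
    by (auto simp: aug intro: lpv.span_base)
  ultimately show "b \<notin> lpv.span (aug s I G \<union> ({b \<in> B. lp_vhom \<delta> d b} - {b}))"
    using lpv.span_minimal[OF _ lpv.subspace_span] by blast
qed

section \<open>The module letterplace embedding\<close>

text \<open>A basis \<open>B0\<close> of \<open>T\<close> is extended by images under
  \<open>\<phi>\<close> of elements of \<open>S\<close> to a basis of the span of both. Let
  \<open>\<psi>\<close> kill \<open>B0\<close> and send every other basis vector to a preimage in
  \<open>S\<close>; the claim modulo \<open>T\<close> then holds on the basis, hence on its
  span.\<close>

lemma (in vector_space) exists_section_modulo:
  assumes \<phi>: "Vector_Spaces.linear scale scale \<phi>" and S: "subspace S" and T: "subspace T"
  obtains \<psi> where "Vector_Spaces.linear scale scale \<psi>" "\<And>v. \<psi> v \<in> S" "\<forall>t\<in>T. \<psi> t = 0"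
    "\<forall>v\<in>S. \<phi> (\<psi> (\<phi> v)) - \<phi> v \<in> T"
proof -
  obtain B0 where B0: "B0 \<subseteq> T" "independent B0" "T \<subseteq> span B0"
    by (rule maximal_independent_subset)
  obtain B where B: "B0 \<subseteq> B" "B \<subseteq> B0 \<union> \<phi> ` S" "independent B" "B0 \<union> \<phi> ` S \<subseteq> span B"
    by (rule maximal_independent_subset_extend[of B0 "B0 \<union> \<phi> ` S"]) (use B0 in auto)
  interpret vector_space_pair scale scale ..
  interpret f: linear scale scale \<phi>
    by (rule \<phi>)
  define pre where "pre b = (if b \<in> B0 then 0 else SOME x. x \<in> S \<and> \<phi> x = b)" for b
  have pre: "pre b \<in> S \<and> \<phi> (pre b) = b" if "b \<in> B" "b \<notin> B0" for b
  proof -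
    have "\<exists>x. x \<in> S \<and> \<phi> x = b"
      using that B(2) by blast
    from someI_ex[OF this] show ?thesis
      using that by (simp add: pre_def)
  qed
  let ?\<psi> = "construct B pre"
  interpret p: linear scale scale ?\<psi>
    by (rule linear_construct[OF B(3)])
  have \<psi>B: "?\<psi> b = pre b" if "b \<in> B" for b
    using construct_basis[OF B(3) that] .
  have 1: "?\<psi> v \<in> S" for v
  proof -
    have "pre ` B \<subseteq> S"
      using pre subspace_0[OF S] by (auto simp: pre_def)
    then show ?thesis
      using construct_in_span[OF B(3), of pre v] span_minimal[OF _ S] by blast
  qed
  have 2: "?\<psi> t = 0" if "t \<in> T" for t
  proof (rule p.eq_0_on_span)
    show "t \<in> span B0"
      using that B0 by blast
    show "?\<psi> b = 0" if "b \<in> B0" for b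
      using that B(1) \<psi>B[of b] by (auto simp: pre_def)
  qed
  have 3: "\<phi> (?\<psi> (\<phi> v)) - \<phi> v \<in> T" if "v \<in> S" for v
  proof (rule span_mapsto_subspace[OF T, of "\<phi> v" B "\<lambda>x. \<phi> (?\<psi> x) - x"])
    show "\<phi> v \<in> span B"
      using that B(4) by blast
    show "\<phi> (?\<psi> b) - b \<in> T" if "b \<in> B" for b
    proof (cases "b \<in> B0")
      case True
      then have "b \<in> T"
        using B0(1) by blast
      then show ?thesis
        using 2[of b] subspace_neg[OF T, of b] by simp
    next
      case False
      then show ?thesis
        using pre[OF that] \<psi>B[OF that] subspace_0[OF T] by simp
    qed
    show "\<phi> (?\<psi> (x + y)) - (x + y) = \<phi> (?\<psi> x) - x + (\<phi> (?\<psi> y) - y)" for x y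
      by (simp add: f.add p.add algebra_simps)
    show "\<phi> (?\<psi> (scale c x)) - scale c x = scale c (\<phi> (?\<psi> x) - x)" for c x
      by (simp add: f.scale p.scale scale_right_diff_distrib)
  qed
  show ?thesis
    by (rule that[of ?\<psi>]) (use 1 2 3 p.linear_axioms in auto)
qed

section \<open>The presentation and the embedding as linear maps\<close>

definition ncscale :: "'k::comm_ring_1 \<Rightarrow> (nat \<Rightarrow> 'x list \<Rightarrow> 'k) \<Rightarrow> nat \<Rightarrow> 'x list \<Rightarrow> 'k" where
  "ncscale c v = (\<lambda>i w. c * v i w)"

interpretation ncv: vector_space "ncscale :: 'k::field \<Rightarrow> (nat \<Rightarrow> 'x list \<Rightarrow> 'k) \<Rightarrow> _"
  by standard (simp_all add: ncscale_def fun_eq_iff fun_at algebra_simps)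

text \<open>Opens sums of vectors at an index without opening sums of their entries, which are
  functions as well.\<close>

lemma plus_at: "(f + h) (i::nat) = f i + h i"
  by (rule plus_fun_apply)

text \<open>Lifts \<open>\<phi>\<close> to representatives over the free algebra.\<close>

definition phi :: "nat \<Rightarrow> (nat \<Rightarrow> nat \<Rightarrow> 'x list \<Rightarrow> 'k::comm_ring_1) \<Rightarrow> (nat \<Rightarrow> 'x list \<Rightarrow> 'k) \<Rightarrow> nat \<Rightarrow> 'x list \<Rightarrow> 'k" where
  "phi s g v = (\<lambda>i. \<Sum>j<s. ncmult (g j i) (v j))"

lemma phi_add: "phi s g (u + v) = phi s g u + phi s g v"
  by (rule ext) (simp add: phi_def plus_at ncmult_add_right sum.distrib)

lemma ncmult_scale_right: "ncmult f (\<lambda>w. c * h w) = (\<lambda>w. c * ncmult f h w)"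
  for c :: "'k::comm_ring_1"
  by (simp add: ncmult_def sum_distrib_left mult.left_commute)

lemma phi_scale: "phi s g (ncscale c v) = ncscale c (phi s g v)"
  by (rule ext)+ (simp add: phi_def ncscale_def ncmult_scale_right sum_fun_at sum_distrib_left)

lemma linear_phi: "Vector_Spaces.linear ncscale ncscale (phi s g)"
  for g :: "nat \<Rightarrow> nat \<Rightarrow> 'x list \<Rightarrow> 'k::field"
  by (intro Vector_Spaces.linear.intro module_hom.intro module_hom_axioms.intro phi_add phi_scale
      ncv.vector_space_axioms ncv.module_axioms)

lemma subspace_ncvec: "ncv.subspace (ncvec s :: (nat \<Rightarrow> 'x list \<Rightarrow> 'k::field) set)"
proof (rule ncv.subspaceI)
  show "ncscale c v \<in> ncvec s" if "v \<in> ncvec s" for c and v :: "nat \<Rightarrow> 'x list \<Rightarrow> 'k"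
    using that by (auto simp: ncvec_def ncscale_def ncpoly_def fun_eq_iff fun_at elim: rev_finite_subset)
qed (auto simp: ncvec_add, simp add: ncvec_def fun_at)

lemma subspace_IV:
  fixes I :: "('x list \<Rightarrow> 'k::field) set"
  assumes I: "nc_graded_ideal I"
  shows "ncv.subspace (IV s I)"
proof (rule ncv.subspaceI)
  show "ncscale c v \<in> IV s I" if "v \<in> IV s I" for c v
    using that ncv.subspace_scale[OF subspace_ncvec, of v s c]
    by (auto simp: IV_def) (simp add: ncscale_def ideal_scale_left[OF I])
qed (auto simp: IV_0[OF I] IV_add[OF I])

definition emb :: "(nat \<Rightarrow> nat) \<Rightarrow> (nat \<Rightarrow> 'x list \<Rightarrow> 'k::comm_ring_1) \<Rightarrow> nat \<Rightarrow> ('x, 'k) lp" where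
  "emb \<Delta> v = (\<lambda>j. lpi (\<Delta> j) (v j))"

lemma lp_embed_emb: "v \<in> ncvec s \<Longrightarrow> lp_embed \<Delta> v = emb \<Delta> v"
  by (rule ext) (simp add: lp_embed_def emb_def lpsigma_funpow_lpiota ncvecD)

lemma emb_lpvec: "v \<in> ncvec s \<Longrightarrow> emb \<Delta> v \<in> lpvec s"
  by (auto simp: emb_def lpvec_def ncvec_beyond)

text \<open>The element \<open>L (v) t\<close> of the overview.\<close>

definition embt :: "(nat \<Rightarrow> nat) \<Rightarrow> 'x lpm \<Rightarrow> (nat \<Rightarrow> 'x list \<Rightarrow> 'k::comm_ring_1) \<Rightarrow> nat \<Rightarrow> ('x, 'k) lp" where
  "embt \<Delta> t v = (\<lambda>j. Poly_Mapping.single t 1 * emb \<Delta> v j)"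

lemma embt_0: "embt \<Delta> t 0 = 0"
  by (simp add: embt_def emb_def fun_eq_iff fun_at)

lemma embt_add: "u \<in> ncvec s \<Longrightarrow> v \<in> ncvec s \<Longrightarrow> embt \<Delta> t (u + v) = embt \<Delta> t u + embt \<Delta> t v"
  by (rule ext) (simp add: embt_def emb_def plus_at lpi_add ncvecD distrib_left)

lemma embt_diff:
  fixes u v :: "nat \<Rightarrow> 'x list \<Rightarrow> 'k::field"
  assumes "u \<in> ncvec s" "v \<in> ncvec s"
  shows "embt \<Delta> t (u - v) = embt \<Delta> t u - embt \<Delta> t v"
  using embt_add[of "u - v" s v] ncv.subspace_diff[OF subspace_ncvec assms] assms
  by (simp add: eq_diff_eq)

lemma embt_sum:
  fixes f :: "'i \<Rightarrow> nat \<Rightarrow> 'x list \<Rightarrow> 'k::field"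
  assumes "\<And>x. x \<in> X \<Longrightarrow> f x \<in> ncvec s"
  shows "embt \<Delta> t (\<Sum>x\<in>X. f x) = (\<Sum>x\<in>X. embt \<Delta> t (f x))"
  using assms
proof (induction X rule: infinite_finite_induct)
  case (insert x X)
  then show ?case
    using embt_add[of "f x" s "sum f X"] ncv.subspace_sum[OF subspace_ncvec, of X f] by simp
qed (simp_all add: embt_0)

lemma single_mult_emb:
  fixes v :: "nat \<Rightarrow> 'x list \<Rightarrow> 'k::comm_ring_1"
  assumes v: "v \<in> ncvec s"
  shows "(\<lambda>j. Poly_Mapping.single t c * emb \<Delta> v j) = embt \<Delta> t (ncscale c v)"
proof
  fix j
  have "lpi (\<Delta> j) (ncscale c v j) = lpi (\<Delta> j) (ncmult (ncmono [] c) (v j))"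
    by (simp add: ncscale_def ncmult_scalar_left)
  also have "\<dots> = Poly_Mapping.single 0 c * lpi (\<Delta> j) (v j)"
    using lpi_mult[of "ncmono [] c" 0 "v j" "\<Delta> j"] ncvecD[OF v, of j]
    by (simp add: nc_hom_def ncmono_apply)
  finally show "Poly_Mapping.single t c * emb \<Delta> v j = embt \<Delta> t (ncscale c v) j"
    by (simp only: embt_def emb_def mult.assoc[symmetric] mult_single) simp
qed

section \<open>Terms at a single basis vector\<close>

definition lpu :: "nat \<Rightarrow> ('x, 'k::comm_ring_1) lp \<Rightarrow> nat \<Rightarrow> ('x, 'k) lp" where
  "lpu j p = (\<lambda>i. if i = j then p else 0)"

lemma lpu_lpvec: "j < s \<Longrightarrow> lpu j p \<in> lpvec s"
  by (auto simp: lpu_def lpvec_def)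

lemma lpvec_expand:
  assumes "v \<in> lpvec s"
  shows "v = (\<Sum>j<s. \<Sum>m\<in>Poly_Mapping.keys (v j). lpu j (Poly_Mapping.single m (Poly_Mapping.lookup (v j) m)))"
proof
  fix i
  have *: "(\<Sum>m\<in>Poly_Mapping.keys p. lpu j (Poly_Mapping.single m (Poly_Mapping.lookup p m)) i) = (if j = i then p else 0)"
    for j and p :: "('a, 'b) lp"
  proof (cases "j = i")
    case True
    have "(\<Sum>m\<in>Poly_Mapping.keys p. Poly_Mapping.single m (Poly_Mapping.lookup p m)) = p"
      by (rule poly_mapping_eqI) (auto simp: lookup_sum lookup_single when_def in_keys_iff sum.delta)
    then show ?thesis
      using True by (simp add: lpu_def)
  qed (simp add: lpu_def)
  show "v i = (\<Sum>j<s. \<Sum>m\<in>Poly_Mapping.keys (v j). lpu j (Poly_Mapping.single m (Poly_Mapping.lookup (v j) m))) i"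
    using assms by (auto simp: sum_fun_at * sum.delta lpvec_def not_less)
qed

lemma embt_ncunit: "embt \<Delta> t (ncunit j w c) = lpu j (Poly_Mapping.single (colw (\<Delta> j) w + t) c)"
  by (rule ext) (simp add: embt_def emb_def ncunit_def lpu_def mult_single add.commute)

lemma sum_keys_single:
  fixes \<theta> :: "'m \<Rightarrow> 'k::comm_ring_1 \<Rightarrow> 'b::comm_monoid_add"
  assumes "\<And>m. \<theta> m 0 = 0"
  shows "(\<Sum>m\<in>Poly_Mapping.keys (Poly_Mapping.single x c). \<theta> m (Poly_Mapping.lookup (Poly_Mapping.single x c) m)) = \<theta> x c"
  using assms by (cases "c = 0") auto

lemma single_mult_lpi:
  "Poly_Mapping.single \<mu> c * lpi k f = (\<Sum>w\<in>{w. f w \<noteq> 0}. Poly_Mapping.single (\<mu> + colw k w) (c * f w))"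
  by (simp add: lpi_def sum_distrib_left mult_single)

section \<open>A section of the presentation on the letterplace side\<close>

definition syz :: "nat \<Rightarrow> ('x list \<Rightarrow> 'k::comm_ring_1) set \<Rightarrow> (nat \<Rightarrow> nat \<Rightarrow> 'x list \<Rightarrow> 'k) \<Rightarrow> (nat \<Rightarrow> 'x list \<Rightarrow> 'k) set" where
  "syz s I g = {v \<in> ncvec s. \<forall>i. phi s g v i \<in> I}"

definition lphi :: "nat \<Rightarrow> (nat \<Rightarrow> nat \<Rightarrow> 'x list \<Rightarrow> 'k::comm_ring_1) \<Rightarrow> (nat \<Rightarrow> ('x, 'k) lp) \<Rightarrow> nat \<Rightarrow> ('x, 'k) lp" where
  "lphi s g v = (\<lambda>i. \<Sum>j<s. lpiota (g j i) * v j)"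

definition Lsyz :: "nat \<Rightarrow> ('x list \<Rightarrow> 'k::comm_ring_1) set \<Rightarrow> (nat \<Rightarrow> nat \<Rightarrow> 'x list \<Rightarrow> 'k) \<Rightarrow> (nat \<Rightarrow> nat) \<Rightarrow> (nat \<Rightarrow> ('x, 'k) lp) set" where
  "Lsyz s I g \<Delta> = lp_sub s (lpJ I) (emb \<Delta> ` syz s I g)"

text \<open>With columns counted from 0, \<open>l < \<Delta> j\<close> stands for
  \<open>1 \<le> l \<le> \<Delta>\<^sub>j\<close>.\<close>

definition Cgens :: "nat \<Rightarrow> (nat \<Rightarrow> nat) \<Rightarrow> (nat \<Rightarrow> ('x, 'k::comm_ring_1) lp) set" where
  "Cgens s \<Delta> = {lpu j (lpvar k l) | j k l. j < s \<and> l < \<Delta> j}"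

text \<open>The map \<open>e\<^sub>i w t \<mapsto> L (\<psi> (e\<^sub>i w)) t\<close>, where \<open>w t\<close> is the decomposition of a monomial into its
  initial run of columns and the rest.\<close>
definition push1 :: "((nat \<Rightarrow> 'x list \<Rightarrow> 'k::comm_ring_1) \<Rightarrow> nat \<Rightarrow> 'x list \<Rightarrow> 'k) \<Rightarrow> (nat \<Rightarrow> nat) \<Rightarrow> nat \<Rightarrow> 'x lpm \<Rightarrow> 'k \<Rightarrow> nat \<Rightarrow> ('x, 'k) lp" where
  "push1 \<psi> \<Delta> i m c = (if \<exists>w t. Dec 0 m w t
     then embt \<Delta> (SOME t. \<exists>w. Dec 0 m w t) (ncscale c (\<psi> (ncunit i (SOME w. \<exists>t. Dec 0 m w t) 1)))
     else 0)"

definition push :: "((nat \<Rightarrow> 'x list \<Rightarrow> 'k::comm_ring_1) \<Rightarrow> nat \<Rightarrow> 'x list \<Rightarrow> 'k) \<Rightarrow> (nat \<Rightarrow> nat) \<Rightarrow> nat \<Rightarrow> ('x, 'k) lp \<Rightarrow> nat \<Rightarrow> ('x, 'k) lp" where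
  "push \<psi> \<Delta> i p = (\<Sum>m\<in>Poly_Mapping.keys p. push1 \<psi> \<Delta> i m (Poly_Mapping.lookup p m))"

context
  fixes I :: "('x list \<Rightarrow> 'k::field) set" and r s :: nat
    and \<psi> :: "(nat \<Rightarrow> 'x list \<Rightarrow> 'k) \<Rightarrow> nat \<Rightarrow> 'x list \<Rightarrow> 'k" and \<Delta> :: "nat \<Rightarrow> nat"
  assumes I: "nc_graded_ideal I"
    and lin: "Vector_Spaces.linear ncscale ncscale \<psi>"
    and \<psi>_vec: "\<And>v. \<psi> v \<in> ncvec s"
    and \<psi>_IV: "\<forall>v\<in>IV r I. \<psi> v = 0"
begin

interpretation l: linear ncscale ncscale \<psi>
  by (rule lin)

lemma ncscale_\<psi>_vec: "ncscale c (\<psi> v) \<in> ncvec s"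
  by (rule ncv.subspace_scale[OF subspace_ncvec \<psi>_vec])

lemma push1_Dec:
  assumes "Dec 0 m w t"
  shows "push1 \<psi> \<Delta> i m c = embt \<Delta> t (\<psi> (ncunit i w c))"
proof -
  have "(SOME t. \<exists>w. Dec 0 m w t) = t" "(SOME w. \<exists>t. Dec 0 m w t) = w"
    using assms Dec_unique[OF assms] by blast+
  moreover have "ncscale c (\<psi> (ncunit i w 1)) = \<psi> (ncunit i w c)"
  proof -
    have "ncscale c (ncunit i w (1::'k)) = ncunit i w c"
      by (auto simp: ncscale_def ncunit_def ncmono_def fun_eq_iff fun_at)
    then show ?thesis
      by (metis l.scale)
  qed
  ultimately show ?thesis
    using assms by (auto simp: push1_def)
qed

text \<open>The default value 0 is harmless: by \<open>Dec_exists\<close> for \<open>a = 0\<close>,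
  such a monomial has a repeated column and vanishes in \<open>S\<close>.\<close>

lemma push1_none: "(\<And>w t. \<not> Dec 0 m w t) \<Longrightarrow> push1 \<psi> \<Delta> i m c = 0"
  by (simp add: push1_def)

lemma push1_0: "push1 \<psi> \<Delta> i m 0 = 0"
  by (simp add: push1_def embt_0)

lemma push1_add: "push1 \<psi> \<Delta> i m (c + d) = push1 \<psi> \<Delta> i m c + push1 \<psi> \<Delta> i m d"
  by (simp add: push1_def ncv.scale_left_distrib embt_add[OF ncscale_\<psi>_vec ncscale_\<psi>_vec])

lemma push_add: "push \<psi> \<Delta> i (p + q) = push \<psi> \<Delta> i p + push \<psi> \<Delta> i q"
  unfolding push_def by (rule sum_keys_add) (simp_all add: push1_add push1_0)

lemma push_0: "push \<psi> \<Delta> i 0 = 0"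
  by (simp add: push_def)

lemma push_single: "push \<psi> \<Delta> i (Poly_Mapping.single m c) = push1 \<psi> \<Delta> i m c"
  unfolding push_def by (rule sum_keys_single) (rule push1_0)

lemma push_sum: "push \<psi> \<Delta> i (\<Sum>x\<in>X. f x) = (\<Sum>x\<in>X. push \<psi> \<Delta> i (f x))"
  by (induction X rule: infinite_finite_induct) (simp_all add: push_0 push_add)

lemma embt_\<psi>_lpvec: "embt \<Delta> t (\<psi> v) \<in> lpvec s"
  using emb_lpvec[OF \<psi>_vec, of \<Delta> v] by (simp add: embt_def lpvec_def)

lemma push1_lpvec: "push1 \<psi> \<Delta> i m c \<in> lpvec s"
  using push1_Dec push1_none embt_\<psi>_lpvec
  by (cases "\<exists>w t. Dec 0 m w t") (fastforce, simp add: lpvec_def fun_at)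

lemma push_lpvec: "push \<psi> \<Delta> i p \<in> lpvec s"
proof -
  have "(\<Sum>m\<in>X. push1 \<psi> \<Delta> i m (Poly_Mapping.lookup p m)) \<in> lpvec s" for X
    by (induction X rule: infinite_finite_induct)
      (auto intro: lpvec_add push1_lpvec, auto simp: lpvec_def fun_at)
  then show ?thesis
    by (simp add: push_def)
qed

text \<open>For a block inside the run, the argument of \<open>\<psi>\<close> becomes
  \<open>u1 f u2 \<in> I\<close>, which \<open>\<psi>\<close> kills; for a block behind the gap,
  \<open>\<psi>\<close> sees the same word in all terms, up to a scalar, and the block remains as a
  factor. A repeated column stays in the rear part \<open>t\<close>.\<close>

lemma push_JV:
  assumes "p \<in> lpJ I" and i: "i < r"
  shows "push \<psi> \<Delta> i p \<in> JV s I"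
  using I assms(1)
proof (induction p rule: lpJ_additive_induct)
  case (dbl \<mu> j k l c)
  show ?case
  proof (cases "\<exists>w t. Dec 0 (\<mu> + dbl j k l) w t")
    case True
    then obtain w t where d: "Dec 0 (\<mu> + dbl j k l) w t"
      by blast
    then obtain t' where t: "t = t' + dbl j k l"
      by (rule Dec_dbl)
    have "push \<psi> \<Delta> i (Poly_Mapping.single (\<mu> + dbl j k l) c) = embt \<Delta> t (\<psi> (ncunit i w c))"
      by (simp only: push_single push1_Dec[OF d])
    moreover have "embt \<Delta> t (\<psi> (ncunit i w c)) j' \<in> lpJ I" for j'
      unfolding embt_def t using lpJ_mult[OF lpJ_dbl] by (metis mult.commute)
    ultimately show ?thesis
      using embt_\<psi>_lpvec by (simp add: JV_def)
  next
    case False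
    then have "push \<psi> \<Delta> i (Poly_Mapping.single (\<mu> + dbl j k l) c) = 0"
      using push1_none[of "\<mu> + dbl j k l"] by (simp only: push_single) blast
    then show ?thesis
      by (simp only: JV_0)
  qed
next
  case (block \<mu> e k f)
  have eq: "push \<psi> \<Delta> i (Poly_Mapping.single \<mu> 1 * lpi k f)
      = (\<Sum>w\<in>{w. f w \<noteq> 0}. push1 \<psi> \<Delta> i (\<mu> + colw k w) (f w))"
    by (simp add: single_mult_lpi push_sum push_single)
  have len: "length w = e" if "w \<in> {w. f w \<noteq> 0}" for w
    using that block(2) by (simp add: nc_hom_def)
  show ?case
  proof (cases "e = 0")
    case True
    show ?thesis
    proof (cases "f = 0")
      case True
      then show ?thesis
        by (simp add: push_0 JV_0)
    next
      case False
      \<comment> \<open>A nonzero constant in \<open>I\<close> makes \<open>S\<close> zero, so only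
        membership in \<open>lpvec s\<close> remains to be checked.\<close>
      then have "I = ncpoly"
        using ideal_degree_0[OF I block(1)] block(2) \<open>e = 0\<close> by blast
      then show ?thesis
        using lpJ_UNIV[OF I] push_lpvec by (simp add: JV_def)
    qed
  next
    case False
    from False show ?thesis
    proof (cases rule: Dec_block_cases[of e 0 \<mu> k])
      case none
      then show ?thesis
        unfolding eq using len by (intro JV_sum) (simp add: push1_none JV_0)
    next
      case (inside u1 u2 t)
      have "(\<Sum>w\<in>{w. f w \<noteq> 0}. push1 \<psi> \<Delta> i (\<mu> + colw k w) (f w))
          = (\<Sum>w\<in>{w. f w \<noteq> 0}. embt \<Delta> t (\<psi> (ncunit i (u1 @ w @ u2) (f w))))"
        using len by (intro sum.cong) (auto simp: push1_Dec[OF inside])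
      also have "\<dots> = embt \<Delta> t (\<psi> (\<Sum>w\<in>{w. f w \<noteq> 0}. ncunit i (u1 @ w @ u2) (f w)))"
        by (simp add: embt_sum[OF \<psi>_vec] l.sum)
      also have "\<psi> (\<Sum>w\<in>{w. f w \<noteq> 0}. ncunit i (u1 @ w @ u2) (f w)) = 0"
      proof (rule \<psi>_IV[rule_format])
        have f: "f = (\<Sum>w\<in>{w. f w \<noteq> 0}. ncmono w (f w))"
          by (rule ncpoly_expand[OF ideal_ncpoly[OF I block(1)]])
        have "ncmult (ncmono u1 1) (ncmult f (ncmono u2 1)) = (\<Sum>w\<in>{w. f w \<noteq> 0}. ncmono (u1 @ w @ u2) (f w))"
          by (subst f) (simp add: ncmult_sum_left ncmult_sum_right)
        then have "(\<Sum>w\<in>{w. f w \<noteq> 0}. ncmono (u1 @ w @ u2) (f w)) \<in> I"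
          using ideal_left[OF I ideal_right[OF I block(1)], of "ncmono u2 1" "ncmono u1 1"] by simp
        then have "(\<Sum>w\<in>{w. f w \<noteq> 0}. ncunit i (u1 @ w @ u2) (f w)) i' \<in> I" for i'
          using ideal_0[OF I] by (cases "i' = i") (simp_all add: sum_fun_at[where ?'b = nat] ncunit_def)
        then show "(\<Sum>w\<in>{w. f w \<noteq> 0}. ncunit i (u1 @ w @ u2) (f w)) \<in> IV r I"
          using i ncv.subspace_sum[OF subspace_ncvec, of _ "\<lambda>w. ncunit i (u1 @ w @ u2) (f w)" r]
          by (simp add: IV_def ncunit_ncvec)
      qed
      finally show ?thesis
        by (simp add: eq embt_0 JV_0)
    next
      case (after u t)
      have "push \<psi> \<Delta> i (Poly_Mapping.single \<mu> 1 * lpi k f) j \<in> lpJ I" for j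
      proof -
        have "push \<psi> \<Delta> i (Poly_Mapping.single \<mu> 1 * lpi k f) j
            = (\<Sum>w\<in>{w. f w \<noteq> 0}. embt \<Delta> (t + colw k w) (\<psi> (ncunit i u (f w))) j)"
          unfolding eq sum_fun_at
          using len by (intro sum.cong) (auto simp: push1_Dec[OF after])
        also have "\<dots> = (\<Sum>w\<in>{w. f w \<noteq> 0}. Poly_Mapping.single (t + colw k w) (f w) * emb \<Delta> (\<psi> (ncunit i u 1)) j)"
        proof (rule sum.cong)
          fix w
          have "ncscale (f w) (ncunit i u (1::'k)) = ncunit i u (f w)"
            by (auto simp: ncscale_def ncunit_def ncmono_def fun_eq_iff fun_at)
          then have "\<psi> (ncunit i u (f w)) = ncscale (f w) (\<psi> (ncunit i u 1))"
            by (metis l.scale)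
          then show "embt \<Delta> (t + colw k w) (\<psi> (ncunit i u (f w))) j
              = Poly_Mapping.single (t + colw k w) (f w) * emb \<Delta> (\<psi> (ncunit i u 1)) j"
            using fun_cong[OF single_mult_emb[OF \<psi>_vec, of "t + colw k w" "f w" \<Delta> "ncunit i u 1"], of j] by simp
        qed simp
        also have "\<dots> = Poly_Mapping.single t 1 * lpi k f * emb \<Delta> (\<psi> (ncunit i u 1)) j"
          by (simp add: single_mult_lpi sum_distrib_right)
        also have "\<dots> = (emb \<Delta> (\<psi> (ncunit i u 1)) j * Poly_Mapping.single t 1) * lpi k f"
          by (simp add: mult_ac)
        finally show ?thesis
          using lpJ_mult[OF lpJ_lpi[OF I block(1)]] by simp
      qed
      then show ?thesis
        using push_lpvec by (simp add: JV_def)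
    qed
  qed
next
  case (add p q)
  then show ?case
    by (simp add: push_add JV_add)
qed

end

section \<open>Generators of the letterplace syzygies\<close>

lemma pfilter_0: "pfilter P 0 = 0"
  by (rule pfilter_none) simp

definition lpsyz :: "nat \<Rightarrow> ('x list \<Rightarrow> 'k::comm_ring_1) set \<Rightarrow> (nat \<Rightarrow> nat \<Rightarrow> 'x list \<Rightarrow> 'k) \<Rightarrow> (nat \<Rightarrow> ('x, 'k) lp) set" where
  "lpsyz s I g = {v \<in> lpvec s. \<forall>i. lphi s g v i \<in> lpJ I}"

lemma lphi_add: "lphi s g (u + v) = lphi s g u + lphi s g v"
  by (rule ext) (simp add: lphi_def plus_at distrib_left sum.distrib)

lemma lphi_mult: "lphi s g (\<lambda>i. c * v i) = (\<lambda>i. c * lphi s g v i)"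
  by (simp add: lphi_def sum_distrib_left mult.left_commute)

lemma lphi_lpu: "j < s \<Longrightarrow> lphi s g (lpu j p) i = lpiota (g j i) * p"
  by (simp add: lphi_def lpu_def if_distrib[of "(*) _"] sum.delta cong: if_cong)

lemma lphi_JV: "v \<in> JV s I \<Longrightarrow> lphi s g v i \<in> lpJ I"
  by (simp add: lphi_def JV_def lpJ_sum lpJ_mult)

lemma lpsyz_add: "u \<in> lpsyz s I g \<Longrightarrow> v \<in> lpsyz s I g \<Longrightarrow> u + v \<in> lpsyz s I g"
  by (simp add: lpsyz_def lpvec_add lphi_add plus_at lpJ_add)

lemma lp_sub_lpsyz: "v \<in> lp_sub s (lpJ I) G \<Longrightarrow> G \<subseteq> lpsyz s I g \<Longrightarrow> v \<in> lpsyz s I g"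
proof (induction rule: lp_sub.induct)
  case (ideal v)
  then have "v \<in> JV s I"
    by (simp add: JV_def)
  with ideal show ?case
    by (simp add: lpsyz_def lphi_JV)
next
  case (add v u)
  then show ?case
    by (simp add: lpsyz_add)
next
  case (smult v c)
  then show ?case
    by (simp add: lpsyz_def lphi_mult lpJ_mult lpvec_def)
qed blast

lemma lp_sub_diff:
  fixes v :: "nat \<Rightarrow> ('x, 'k::comm_ring_1) lp"
  assumes "v \<in> lp_sub s J G" "u \<in> lp_sub s J G"
  shows "v - u \<in> lp_sub s J G"
  using lp_sub.add[OF assms(1) lp_sub_uminus[OF assms(2)]] by simp

text \<open>Marks the monomials \<open>m\<close> for which \<open>\<epsilon>'\<^sub>j m\<close> is a
  multiple of a generator of \<open>C\<close>.\<close>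

definition low :: "(nat \<Rightarrow> nat) \<Rightarrow> nat \<Rightarrow> 'x lpm \<Rightarrow> bool" where
  "low \<Delta> j m \<longleftrightarrow> (\<exists>k l. l < \<Delta> j \<and> Poly_Mapping.lookup m (k, l) \<noteq> 0)"

locale letterplace_syzygies =
  fixes I :: "('x list \<Rightarrow> 'k::field) set" and r s :: nat
    and g :: "nat \<Rightarrow> nat \<Rightarrow> 'x list \<Rightarrow> 'k" and \<Delta> :: "nat \<Rightarrow> nat"
  assumes I: "nc_graded_ideal I"
    and g_vec: "\<And>j. j < s \<Longrightarrow> g j \<in> ncvec r"
    and g_hom: "\<And>j i. j < s \<Longrightarrow> nc_hom (\<Delta> j) (g j i)"
begin

lemma g_ncpoly: "j < s \<Longrightarrow> g j i \<in> ncpoly"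
  using g_vec by (rule ncvecD)

abbreviation "Cmod \<equiv> lp_sub s (lpJ I) (Cgens s \<Delta> :: (nat \<Rightarrow> ('x, 'k) lp) set)"

text \<open>Every monomial of \<open>\<iota> (g j)\<close> already has a letter in each column below
  \<open>\<Delta> j\<close>, so multiplying by a variable in such a column repeats the column and
  lands in \<open>Q\<close>.\<close>

lemma Cgens_lpsyz: "Cgens s \<Delta> \<subseteq> lpsyz s I g"
proof
  fix v :: "nat \<Rightarrow> ('x, 'k) lp"
  assume "v \<in> Cgens s \<Delta>"
  then obtain j k l where v: "v = lpu j (lpvar k l)" and j: "j < s" and l: "l < \<Delta> j"
    unfolding Cgens_def by blast
  have "lpiota (g j i) * lpvar k l \<in> lpJ I" for i
  proof -
    have "lpiota (g j i) * lpvar k l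
        = (\<Sum>w\<in>{w. g j i w \<noteq> 0}. Poly_Mapping.single (colw 0 w + Poly_Mapping.single (k, l) 1) (g j i w))"
      by (simp add: lpiota_lpi lpi_def lpvar_def sum_distrib_right mult_single)
    also have "\<dots> \<in> lpJ I"
    proof (rule lpJ_sum)
      fix w
      assume "w \<in> {w. g j i w \<noteq> 0}"
      then have "l < length w"
        using g_hom[OF j, of i] l by (auto simp: nc_hom_def)
      then obtain m where m: "colw 0 w = m + Poly_Mapping.single (w ! l, 0 + l) 1"
        by (rule colw_nth_split)
      then have "colw 0 w + Poly_Mapping.single (k, l) 1 = m + dbl (w ! l) k l"
        by (simp add: add.assoc)
      then show "Poly_Mapping.single (colw 0 w + Poly_Mapping.single (k, l) 1) (g j i w) \<in> lpJ I"
        using lpJ_dbl by metis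
    qed
    finally show ?thesis .
  qed
  then show "v \<in> lpsyz s I g"
    using j by (simp add: v lpsyz_def lpu_lpvec lphi_lpu)
qed

text \<open>The shift by \<open>\<Delta> j\<close> puts \<open>v j\<close> right behind the columns
  of \<open>g j\<close>, so products become concatenations by \<open>lpi_mult\<close>.\<close>

lemma lphi_emb:
  assumes v: "v \<in> ncvec s"
  shows "lphi s g (emb \<Delta> v) i = lpi 0 (phi s g v i)"
proof -
  have "lphi s g (emb \<Delta> v) i = (\<Sum>j<s. lpi 0 (ncmult (g j i) (v j)))"
    unfolding lphi_def emb_def lpiota_lpi
  proof (rule sum.cong)
    fix j
    assume j: "j \<in> {..<s}"
    show "lpi 0 (g j i) * lpi (\<Delta> j) (v j) = lpi 0 (ncmult (g j i) (v j))"
      using lpi_mult[of "g j i" "\<Delta> j" "v j" 0] j g_ncpoly g_hom ncvecD[OF v] by simp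
  qed simp
  also have "\<dots> = lpi 0 (phi s g v i)"
    unfolding phi_def
    by (rule lpi_sum[THEN conjunct1, symmetric]) (simp add: ncmult_ncpoly g_ncpoly ncvecD[OF v])
  finally show ?thesis .
qed

lemma emb_syz_lpsyz: "emb \<Delta> ` syz s I g \<subseteq> lpsyz s I g"
  by (auto simp: syz_def lpsyz_def emb_lpvec lphi_emb lpJ_lpi[OF I])

lemma low_in_C:
  assumes j: "j < s" and l: "l < \<Delta> j" and m: "Poly_Mapping.lookup m (k, l) \<noteq> 0"
  shows "lpu j (Poly_Mapping.single m c) \<in> Cmod"
proof -
  obtain m' where m': "m = m' + Poly_Mapping.single (k, l) 1"
    using m by (rule lookup_pos_split)
  have "(\<lambda>i. Poly_Mapping.single m' c * lpu j (lpvar k l) i) \<in> Cmod"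
    using j l by (intro lp_sub.smult lp_sub.gen) (auto simp: Cgens_def)
  also have "(\<lambda>i. Poly_Mapping.single m' c * lpu j (lpvar k l) i) = lpu j (Poly_Mapping.single m c)"
    by (rule ext) (simp add: lpu_def lpvar_def mult_single m')
  finally show ?thesis .
qed

lemma lpsyz_split:
  assumes v: "v \<in> lpsyz s I g"
  obtains c u where "c \<in> Cmod" "u \<in> Lsyz s I g \<Delta>" "v = c + u"
proof -
  obtain \<psi> where lin: "Vector_Spaces.linear ncscale ncscale \<psi>" and \<psi>_vec: "\<And>v. \<psi> v \<in> ncvec s"
    and \<psi>_IV: "\<forall>v\<in>IV r I. \<psi> v = 0"
    and sec: "\<forall>v\<in>ncvec s. phi s g (\<psi> (phi s g v)) - phi s g v \<in> IV r I"
    by (rule ncv.exists_section_modulo[OF linear_phi[of s g] subspace_ncvec[of s] subspace_IV[OF I, of r]]) (rule that)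
  interpret l: linear ncscale ncscale \<psi>
    by (rule lin)
  note push_rules = push_add[OF I lin \<psi>_vec \<psi>_IV] push_sum[OF I lin \<psi>_vec \<psi>_IV]
    push_single[OF I lin \<psi>_vec \<psi>_IV]
  \<comment> \<open>This is \<open>\<Psi> (\<phi>' v)\<close> of the overview:
    \<open>\<phi>'\<close> is applied first, then \<open>push\<close> at every position of
    \<open>S^r\<close>.\<close>
  define \<Psi> where "\<Psi> v = (\<Sum>i<r. push \<psi> \<Delta> i (lphi s g v i))" for v
  have \<Psi>_add: "\<Psi> (u + v) = \<Psi> u + \<Psi> v" for u v
    by (simp add: \<Psi>_def lphi_add plus_at push_rules sum.distrib)
  have \<Psi>_0: "\<Psi> 0 = 0"
    using \<Psi>_add[of 0 0] by simp
  have \<Psi>_JV: "\<Psi> v \<in> JV s I" if "\<And>i. lphi s g v i \<in> lpJ I" for v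
    unfolding \<Psi>_def using that by (intro JV_sum push_JV[OF I lin \<psi>_vec \<psi>_IV]) auto
  let ?LK = "Lsyz s I g \<Delta>"
  have JV_LK: "v \<in> ?LK" if "v \<in> JV s I" for v
    using that by (simp add: Lsyz_def JV_lp_sub)
  have diff_LK: "u - v \<in> ?LK" if "u \<in> ?LK" "v \<in> ?LK" for u v
    using that unfolding Lsyz_def by (rule lp_sub_diff)
  \<comment> \<open>Terms without low columns are treated one by one; if such a term has a
    decomposition, the difference is the embedding of \<open>u - \<psi> (\<phi> u)\<close>, times
    \<open>t\<close>.\<close>
  have single: "lpu j (Poly_Mapping.single m c) - \<Psi> (lpu j (Poly_Mapping.single m c)) \<in> ?LK"
    if j: "j < s" and m: "\<not> low \<Delta> j m" for j m c
  proof -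
    have "Poly_Mapping.lookup m (k, l) = 0" if "l < \<Delta> j" for k l
      using m that by (auto simp: low_def)
    then consider (Dec) w t where "Dec (\<Delta> j) m w t" | (dbl) \<mu> i k l where "m = \<mu> + dbl i k l"
      using Dec_exists[of "\<Delta> j" m] by blast
    then show ?thesis
    proof cases
      case Dec
      let ?e = "ncunit j w c"
      have m_eq: "m = colw (\<Delta> j) w + t" and t: "\<And>i l. l \<le> \<Delta> j + length w \<Longrightarrow> Poly_Mapping.lookup t (i, l) = 0"
        using Dec by (auto simp: Dec_def)
      have e: "?e \<in> ncvec s"
        using j by (rule ncunit_ncvec)
      have "\<Psi> (lpu j (Poly_Mapping.single m c))
          = (\<Sum>i<r. \<Sum>u\<in>{u. g j i u \<noteq> 0}. embt \<Delta> t (\<psi> (ncunit i (u @ w) (g j i u * c))))"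
        unfolding \<Psi>_def
      proof (rule sum.cong)
        fix i
        have "lphi s g (lpu j (Poly_Mapping.single m c)) i
            = (\<Sum>u\<in>{u. g j i u \<noteq> 0}. Poly_Mapping.single (colw 0 u + m) (g j i u * c))"
          using j by (simp add: lphi_lpu lpiota_lpi lpi_def sum_distrib_right mult_single)
        then have "push \<psi> \<Delta> i (lphi s g (lpu j (Poly_Mapping.single m c)) i)
            = (\<Sum>u\<in>{u. g j i u \<noteq> 0}. push1 \<psi> \<Delta> i (colw 0 u + m) (g j i u * c))"
          by (simp add: push_rules)
        also have "\<dots> = (\<Sum>u\<in>{u. g j i u \<noteq> 0}. embt \<Delta> t (\<psi> (ncunit i (u @ w) (g j i u * c))))"
        proof (rule sum.cong)
          fix u
          assume "u \<in> {u. g j i u \<noteq> 0}"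
          then have "length u = \<Delta> j"
            using g_hom[OF j, of i] by (auto simp: nc_hom_def)
          \<comment> \<open>\<open>u\<close> fills all columns below \<open>\<Delta> j\<close>,
            where the run of \<open>m\<close> begins, so the two runs merge into
            \<open>u @ w\<close> and the part behind the gap stays \<open>t\<close>.\<close>
          then have "Dec 0 (colw 0 u + m) (u @ w) t"
            using t by (simp add: Dec_def m_eq colw_append add.assoc)
          then show "push1 \<psi> \<Delta> i (colw 0 u + m) (g j i u * c) = embt \<Delta> t (\<psi> (ncunit i (u @ w) (g j i u * c)))"
            by (rule push1_Dec[OF I lin \<psi>_vec \<psi>_IV])
        qed simp
        finally show "push \<psi> \<Delta> i (lphi s g (lpu j (Poly_Mapping.single m c)) i) = \<dots>" .
      qed simp
      also have "\<dots> = embt \<Delta> t (\<psi> (\<Sum>i<r. \<Sum>u\<in>{u. g j i u \<noteq> 0}. ncunit i (u @ w) (g j i u * c)))"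
        by (simp add: l.sum embt_sum[OF \<psi>_vec] embt_sum[OF ncv.subspace_sum[OF subspace_ncvec \<psi>_vec]])
      also have "(\<Sum>i<r. \<Sum>u\<in>{u. g j i u \<noteq> 0}. ncunit i (u @ w) (g j i u * c)) = phi s g ?e"
      proof
        fix i
        have mono: "ncmult (g j i) (ncmono w c) = (\<Sum>u\<in>{u. g j i u \<noteq> 0}. ncmono (u @ w) (g j i u * c))"
          by (subst ncpoly_expand[OF ncvecD[OF g_vec[OF j]]]) (simp add: ncmult_sum_left)
        have "phi s g ?e i = ncmult (g j i) (ncmono w c)"
          using j by (simp add: phi_def ncunit_def if_distrib[of "ncmult _"] sum.delta cong: if_cong)
        moreover have "ncmult (g j i) (ncmono w c) = 0" if "\<not> i < r"
          using ncvec_beyond[OF g_vec[OF j], of i] that by simp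
        moreover have "(\<Sum>i'<r. \<Sum>u\<in>{u. g j i' u \<noteq> 0}. ncunit i' (u @ w) (g j i' u * c)) i
            = (\<Sum>i'<r. if i' = i then ncmult (g j i) (ncmono w c) else 0)"
          unfolding sum_fun_at[where ?'b = nat] by (rule sum.cong) (auto simp: ncunit_def mono)
        ultimately show "(\<Sum>i<r. \<Sum>u\<in>{u. g j i u \<noteq> 0}. ncunit i (u @ w) (g j i u * c)) i = phi s g ?e i"
          by (auto simp: sum.delta)
      qed
      finally have \<Psi>: "\<Psi> (lpu j (Poly_Mapping.single m c)) = embt \<Delta> t (\<psi> (phi s g ?e))" .
      have "lpu j (Poly_Mapping.single m c) - \<Psi> (lpu j (Poly_Mapping.single m c))
          = embt \<Delta> t (?e - \<psi> (phi s g ?e))"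
        unfolding \<Psi> embt_diff[OF e \<psi>_vec] by (simp add: embt_ncunit m_eq)
      also have "\<dots> \<in> ?LK"
      proof -
        let ?d = "?e - \<psi> (phi s g ?e)"
        interpret f: linear ncscale ncscale "phi s g"
          by (rule linear_phi)
        \<comment> \<open>\<open>\<phi> \<psi> \<phi> = \<phi>\<close> modulo \<open>I\<close> makes
          \<open>?d\<close> a syzygy.\<close>
        have "phi s g ?d = - (phi s g (\<psi> (phi s g ?e)) - phi s g ?e)"
          by (simp add: f.diff)
        then have "phi s g ?d \<in> IV r I"
          using ncv.subspace_neg[OF subspace_IV[OF I] sec[rule_format, OF e]] by simp
        moreover have "?d \<in> ncvec s"
          by (rule ncv.subspace_diff[OF subspace_ncvec e \<psi>_vec])
        ultimately have "?d \<in> syz s I g"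
          by (simp add: syz_def IV_def)
        then show ?thesis
          unfolding embt_def Lsyz_def by (intro lp_sub.smult lp_sub.gen imageI)
      qed
      finally show ?thesis .
    next
      case dbl
      \<comment> \<open>The term vanishes in \<open>S\<close>, and so does its image under
        \<open>\<phi>'\<close>; hence both parts of the difference lie in
        \<open>JV s I\<close>.\<close>
      have "lpu j (Poly_Mapping.single m c) \<in> JV s I"
        using lpJ_dbl[of \<mu> i l k c I] lpu_lpvec[OF j] by (auto simp: JV_def lpu_def dbl lpJ_0)
      then show ?thesis
        by (intro diff_LK JV_LK \<Psi>_JV lphi_JV)
    qed
  qed
  define vl where "vl = (\<lambda>j. pfilter (low \<Delta> j) (v j))"
  define vh where "vh = (\<lambda>j. pfilter (\<lambda>m. \<not> low \<Delta> j m) (v j))"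
  have v_lpvec: "v \<in> lpvec s"
    using v by (simp add: lpsyz_def)
  have split: "v = vl + vh"
    by (rule ext, rule poly_mapping_eqI) (simp add: vl_def vh_def plus_at lookup_add lookup_pfilter)
  have vec: "vl \<in> lpvec s" "vh \<in> lpvec s"
    using v_lpvec by (simp_all add: vl_def vh_def lpvec_def pfilter_0)
  have vl_C: "vl \<in> Cmod"
    by (subst lpvec_expand[OF vec(1)], intro lp_sub_sum)
      (auto simp: vl_def low_def lookup_pfilter in_keys_iff split: if_splits intro: low_in_C)
  then have "vh \<in> lpsyz s I g"
  proof -
    \<comment> \<open>\<open>C\<close> consists of syzygies, so removing the low part leaves a
      syzygy, and \<open>\<Psi> vh\<close> vanishes modulo \<open>J\<close>.\<close>
    have "- vl \<in> lpsyz s I g"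
      using lp_sub_lpsyz[OF lp_sub_uminus[OF vl_C] Cgens_lpsyz] .
    then have "v + - vl \<in> lpsyz s I g"
      using v lpsyz_add by blast
    then show ?thesis
      by (simp add: split)
  qed
  then have "\<Psi> vh \<in> ?LK"
    by (intro JV_LK \<Psi>_JV) (simp add: lpsyz_def)
  have "vh - \<Psi> vh \<in> ?LK"
  proof -
    have sum: "(\<Sum>x\<in>X. f x) - \<Psi> (\<Sum>x\<in>X. f x) \<in> ?LK" if "\<And>x. x \<in> X \<Longrightarrow> f x - \<Psi> (f x) \<in> ?LK"
      for X :: "'z set" and f
    proof -
      have "(\<Sum>x\<in>X. f x) - \<Psi> (\<Sum>x\<in>X. f x) = (\<Sum>x\<in>X. f x - \<Psi> (f x))"
        by (induction X rule: infinite_finite_induct) (simp_all add: \<Psi>_0 \<Psi>_add del: minus_apply)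
      then show ?thesis
        using that by (simp add: Lsyz_def lp_sub_sum)
    qed
    show ?thesis
      by (subst (1 2) lpvec_expand[OF vec(2)], intro sum single)
        (auto simp: vh_def lookup_pfilter in_keys_iff split: if_splits)
  qed
  then have "(vh - \<Psi> vh) + \<Psi> vh \<in> ?LK"
    using \<open>\<Psi> vh \<in> ?LK\<close> unfolding Lsyz_def by (rule lp_sub.add)
  then show ?thesis
    using that[OF vl_C _ split] by simp
qed

end

section \<open>Reading off the initial run and the low part\<close>

text \<open>Reads the coefficients of those monomials that consist of a run from
  \<open>\<Delta> j\<close> on and nothing else. By \<open>unemb_emb\<close> it is a left inverse of
  the embedding.\<close>

definition unemb :: "(nat \<Rightarrow> nat) \<Rightarrow> (nat \<Rightarrow> ('x, 'k::comm_ring_1) lp) \<Rightarrow> nat \<Rightarrow> 'x list \<Rightarrow> 'k" where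
  "unemb \<Delta> v = (\<lambda>j w. Poly_Mapping.lookup (v j) (colw (\<Delta> j) w))"

lemma unemb_add: "unemb \<Delta> (u + v) = unemb \<Delta> u + unemb \<Delta> v"
  by (simp add: unemb_def fun_eq_iff fun_at lookup_add)

lemma unemb_emb: "v \<in> ncvec s \<Longrightarrow> unemb \<Delta> (emb \<Delta> v) = v"
  by (simp add: unemb_def emb_def lookup_lpi_colw ncvecD)

lemma lookup_colw_ncpoly: "(\<lambda>w. Poly_Mapping.lookup p (colw a w)) \<in> ncpoly"
proof -
  have "finite (colw a -` Poly_Mapping.keys p)"
    by (rule finite_vimageI) (auto simp: inj_def colw_inject)
  then show ?thesis
    by (simp add: ncpoly_def vimage_def in_keys_iff)
qed

lemma Dec_colw_rest: "Dec a (colw a v) w t \<Longrightarrow> w = v \<and> t = 0"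
  using Dec_unique[OF _ Dec_colw] by blast

text \<open>Only monomials without a part behind the gap are read. A nonempty block behind the gap
  never yields one, and a block inside the run contributes \<open>u1 f u2\<close> or
  nothing.\<close>

lemma lpJ_lookup_colw:
  fixes I :: "('x list \<Rightarrow> 'k::field) set"
  assumes I: "nc_graded_ideal I" and "p \<in> lpJ I"
  shows "(\<lambda>w. Poly_Mapping.lookup p (colw a w)) \<in> I"
  using I assms(2)
proof (induction p rule: lpJ_additive_induct)
  case (dbl \<mu> i k j c)
  have "\<mu> + dbl i k j \<noteq> colw a w" for w
  proof
    assume "\<mu> + dbl i k j = colw a w"
    then have "Dec a (\<mu> + dbl i k j) w 0"
      using Dec_colw by metis
    then obtain t' where "0 = t' + dbl i k j"
      by (rule Dec_dbl)
    then have "mdeg (t' + dbl i k j) = 0"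
      by (metis mdeg_0)
    then show False
      by (simp add: mdeg_add)
  qed
  then have "(\<lambda>w. Poly_Mapping.lookup (Poly_Mapping.single (\<mu> + dbl i k j) c) (colw a w)) = 0"
    by (simp only: lookup_single when_def if_False zero_fun_def)
  then show ?case
    by (simp only: ideal_0[OF I])
next
  case (block \<mu> e k f)
  have eq: "Poly_Mapping.lookup (Poly_Mapping.single \<mu> 1 * lpi k f) (colw a v)
      = (\<Sum>w\<in>{w. f w \<noteq> 0}. f w when \<mu> + colw k w = colw a v)" for v
    by (simp add: single_mult_lpi lookup_sum lookup_single)
  have len: "length w = e" if "f w \<noteq> 0" for w
    using that block(2) by (simp add: nc_hom_def)
  have zero: ?case if "\<And>v w. f w \<noteq> 0 \<Longrightarrow> \<mu> + colw k w \<noteq> colw a v"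
  proof -
    have "(\<lambda>v. Poly_Mapping.lookup (Poly_Mapping.single \<mu> 1 * lpi k f) (colw a v)) = 0"
      using that by (simp add: eq fun_eq_iff fun_at)
    then show ?thesis
      by (simp only: ideal_0[OF I])
  qed
  show ?case
  proof (cases "e = 0")
    case True
    show ?thesis
    proof (cases "f = 0")
      case True
      then show ?thesis
        by (intro zero) (simp add: fun_at)
    next
      case False
      then have "I = ncpoly"
        using ideal_degree_0[OF I block(1)] block(2) \<open>e = 0\<close> by blast
      then show ?thesis
        using lookup_colw_ncpoly by blast
    qed
  next
    case False
    from False show ?thesis
    proof (cases rule: Dec_block_cases[of e a \<mu> k])
      case none
      show ?thesis
        by (rule zero) (metis Dec_colw len none)
    next
      case (inside u1 u2 t)
      show ?thesis
      proof (cases "t = 0")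
        case True
        then have \<mu>: "\<mu> + colw k w = colw a (u1 @ w @ u2)" if "f w \<noteq> 0" for w
          using inside[OF len[OF that]] by (simp add: Dec_def)
        have f: "f = (\<Sum>w\<in>{w. f w \<noteq> 0}. ncmono w (f w))"
          by (rule ncpoly_expand[OF ideal_ncpoly[OF I block(1)]])
        have "ncmult (ncmono u1 1) (ncmult f (ncmono u2 1)) = (\<Sum>w\<in>{w. f w \<noteq> 0}. ncmono (u1 @ w @ u2) (f w))"
          by (subst f) (simp add: ncmult_sum_left ncmult_sum_right)
        also have "\<dots> = (\<lambda>v. Poly_Mapping.lookup (Poly_Mapping.single \<mu> 1 * lpi k f) (colw a v))"
          unfolding eq
          by (rule ext, unfold sum_fun_at, rule sum.cong) (auto simp: \<mu> colw_inject ncmono_apply when_def)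
        finally show ?thesis
          using ideal_left[OF I ideal_right[OF I block(1)], of "ncmono u2 1" "ncmono u1 1"] by simp
      next
        case False
        show ?thesis
          by (rule zero) (metis Dec_colw_rest False len inside)
      qed
    next
      case (after u t)
      have "t + colw k w \<noteq> 0" if "f w \<noteq> 0" for w
        using len[OF that] False by (metis mdeg_colw mdeg_0 lpm_add_eq_0)
      then show ?thesis
        by (intro zero) (metis Dec_colw_rest len after)
    qed
  qed
next
  case (add p q)
  then show ?case
    using ideal_add[OF I] by (fastforce simp: lookup_add plus_fun_def)
qed

lemma unemb_JV:
  fixes I :: "('x list \<Rightarrow> 'k::field) set"
  assumes I: "nc_graded_ideal I" and v: "v \<in> JV s I"
  shows "unemb \<Delta> v \<in> IV s I"
proof -
  have "unemb \<Delta> v j \<in> I" for j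
    unfolding unemb_def by (rule lpJ_lookup_colw[OF I]) (use v in \<open>simp add: JV_def\<close>)
  moreover have "unemb \<Delta> v \<in> ncvec s"
    using v lookup_colw_ncpoly by (auto simp: JV_def lpvec_def unemb_def ncvec_def zero_fun_def)
  ultimately show ?thesis
    by (simp add: IV_def)
qed

text \<open>All words in \<open>emb \<Delta> b\<close> end just before column \<open>d\<close>, at
  every index \<open>j\<close>. A product with \<open>\<mu>\<close> is a run only if
  \<open>\<mu> = colw d u\<close> continues it from there, and then it spells the words of
  \<open>b u\<close>.\<close>

lemma unemb_single_mult_emb:
  fixes b :: "nat \<Rightarrow> 'x list \<Rightarrow> 'k::comm_ring_1"
  assumes b: "b \<in> ncvec s" "nc_vhom \<Delta> d b"
  obtains "unemb \<Delta> (\<lambda>i. Poly_Mapping.single \<mu> c * emb \<Delta> b i) = 0"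
    | u where "unemb \<Delta> (\<lambda>i. Poly_Mapping.single \<mu> c * emb \<Delta> b i) = (\<lambda>i. ncmult (b i) (ncmono u c))"
proof -
  let ?x = "\<lambda>i. Poly_Mapping.single \<mu> c * emb \<Delta> b i"
  have eq: "unemb \<Delta> ?x j v
      = (\<Sum>w\<in>{w. b j w \<noteq> 0}. c * b j w when \<mu> + colw (\<Delta> j) w = colw (\<Delta> j) v)" for j v
    by (simp add: unemb_def emb_def single_mult_lpi lookup_sum lookup_single)
  have deg: "\<Delta> j + length w = d" if "b j w \<noteq> 0" for j w
    using that b(2) by (auto simp: nc_vhom_def add.commute)
  show ?thesis
  proof (cases "\<exists>u. \<mu> = colw d u")
    case True
    then obtain u where u: "\<mu> = colw d u"
      by blast
    have "unemb \<Delta> ?x j = ncmult (b j) (ncmono u c)" for j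
    proof
      fix v
      have "ncmult (b j) (ncmono u c) = (\<Sum>w\<in>{w. b j w \<noteq> 0}. ncmono (w @ u) (b j w * c))"
        by (subst ncpoly_expand[OF ncvecD[OF b(1)]]) (simp add: ncmult_sum_left)
      moreover have "\<mu> + colw (\<Delta> j) w = colw (\<Delta> j) (w @ u)" if "b j w \<noteq> 0" for w
        using deg[OF that] by (simp add: u colw_append add.commute)
      ultimately show "unemb \<Delta> ?x j v = ncmult (b j) (ncmono u c) v"
        unfolding eq sum_fun_at
        by (simp add: sum_fun_at)
          (rule sum.cong, auto simp: colw_inject ncmono_apply when_def mult.commute)
    qed
    then show ?thesis
      using that(2) by blast
  next
    case False
    have "\<mu> + colw (\<Delta> j) w \<noteq> colw (\<Delta> j) v" if "b j w \<noteq> 0" for j w v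
      using colw_prefix[of \<mu> "\<Delta> j" w v] deg[OF that] False by metis
    then have "unemb \<Delta> ?x = 0"
      by (intro ext) (simp add: eq fun_at)
    then show ?thesis
      by (rule that(1))
  qed
qed

section \<open>The projection to the low monomials\<close>

definition lowpart :: "(nat \<Rightarrow> nat) \<Rightarrow> (nat \<Rightarrow> ('x, 'k::comm_ring_1) lp) \<Rightarrow> nat \<Rightarrow> ('x, 'k) lp" where
  "lowpart \<Delta> v = (\<lambda>j. pfilter (low \<Delta> j) (v j))"

lemma lowpart_add: "lowpart \<Delta> (u + v) = lowpart \<Delta> u + lowpart \<Delta> v"
  by (rule ext) (simp add: lowpart_def plus_at pfilter_add)

lemma lowpart_sum: "lowpart \<Delta> (\<Sum>x\<in>X. f x) = (\<Sum>x\<in>X. lowpart \<Delta> (f x))"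
proof -
  have "lowpart \<Delta> 0 = 0"
    using lowpart_add[of \<Delta> 0 0] by simp
  then show ?thesis
    by (induction X rule: infinite_finite_induct) (simp_all add: lowpart_add)
qed

text \<open>The right-hand side depends on \<open>w\<close> through its length only, as
  \<open>pfilter_lpJ\<close> requires.\<close>

lemma low_colw:
  "low \<Delta> j (\<mu> + colw a w) \<longleftrightarrow> low \<Delta> j \<mu> \<or> (\<exists>l<\<Delta> j. a \<le> l \<and> l < a + length w)"
  by (auto simp: low_def lookup_add lookup_colw split: if_splits)

lemma lowpart_JV:
  fixes I :: "('x list \<Rightarrow> 'k::field) set"
  assumes I: "nc_graded_ideal I" and v: "v \<in> JV s I"
  shows "lowpart \<Delta> v \<in> JV s I"
proof -
  have "pfilter (low \<Delta> j) (v j) \<in> lpJ I" for j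
    by (rule pfilter_lpJ[OF I]) (use v in \<open>auto simp: JV_def low_colw\<close>)
  then show ?thesis
    using v by (auto simp: JV_def lpvec_def lowpart_def pfilter_0)
qed

lemma lp_vhom_emb:
  fixes b :: "nat \<Rightarrow> 'x list \<Rightarrow> 'k::comm_ring_1"
  assumes "b \<in> ncvec s"
  shows "lp_vhom \<Delta> d (emb \<Delta> b) \<longleftrightarrow> nc_vhom \<Delta> d b"
proof
  assume "nc_vhom \<Delta> d b"
  then show "lp_vhom \<Delta> d (emb \<Delta> b)"
    using keys_lpi by (fastforce simp: lp_vhom_def nc_vhom_def emb_def)
next
  assume hom: "lp_vhom \<Delta> d (emb \<Delta> b)"
  show "nc_vhom \<Delta> d b"
    unfolding nc_vhom_def
  proof (intro allI impI)
    fix j w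
    assume "b j w \<noteq> 0"
    then have "colw (\<Delta> j) w \<in> Poly_Mapping.keys (emb \<Delta> b j)"
      using lookup_lpi_colw[OF ncvecD[OF assms, of j]] by (simp add: emb_def in_keys_iff)
    then have "mdeg (colw (\<Delta> j) w) + \<Delta> j = d"
      using hom unfolding lp_vhom_def by blast
    then show "length w + \<Delta> j = d"
      by simp
  qed
qed

text \<open>In each nonzero entry \<open>b i\<close> the words have length
  \<open>d - \<Delta> i\<close>, so a word appended to them starts at column \<open>d\<close>
  whatever \<open>i\<close> is.\<close>

lemma emb_mult_mono:
  fixes b :: "nat \<Rightarrow> 'x list \<Rightarrow> 'k::comm_ring_1"
  assumes b: "b \<in> ncvec s" "nc_vhom \<Delta> d b"
  shows "emb \<Delta> (\<lambda>i. ncmult (b i) (ncmono w c)) = (\<lambda>i. Poly_Mapping.single (colw d w) c * emb \<Delta> b i)"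
proof
  fix i
  show "emb \<Delta> (\<lambda>i. ncmult (b i) (ncmono w c)) i = Poly_Mapping.single (colw d w) c * emb \<Delta> b i"
  proof (cases "b i = 0")
    case True
    then show ?thesis by (simp add: emb_def)
  next
    case False
    then obtain v where "b i v \<noteq> 0"
      by (auto simp: fun_eq_iff fun_at)
    \<comment> \<open>A nonzero entry ensures \<open>\<Delta> i \<le> d\<close>, so that the
      difference \<open>d - \<Delta> i\<close> is not truncated.\<close>
    then have "length v + \<Delta> i = d"
      using b(2) unfolding nc_vhom_def by blast
    then have "\<Delta> i \<le> d"
      by simp
    moreover have "nc_hom (d - \<Delta> i) (b i)"
      using b(2) unfolding nc_vhom_def nc_hom_def by (metis add_diff_cancel_right')
    ultimately show ?thesis
      using lpi_mult[of "b i" "d - \<Delta> i" "ncmono w c" "\<Delta> i"] ncvecD[OF b(1)]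
      by (simp add: emb_def mult.commute)
  qed
qed

lemma emb_IV:
  fixes I :: "('x list \<Rightarrow> 'k::field) set"
  assumes "nc_graded_ideal I" "v \<in> IV s I"
  shows "emb \<Delta> v \<in> JV s I"
  using assms by (auto simp: JV_def IV_def emb_lpvec) (simp add: emb_def lpJ_lpi)

section \<open>A minimal basis of the letterplace syzygies\<close>

declare minus_apply [simp del] uminus_apply [simp del]

lemma not_low_colw: "\<not> low \<Delta> j (colw (\<Delta> j) w)"
  by (auto simp: low_def lookup_colw)

context letterplace_syzygies
begin

lemma syz_ncvec: "v \<in> syz s I g \<Longrightarrow> v \<in> ncvec s"
  by (simp add: syz_def)

lemma lowpart_lpu_low: "low \<Delta> j m \<Longrightarrow> lowpart \<Delta> (lpu j (Poly_Mapping.single m c)) = lpu j (Poly_Mapping.single m c)"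
  by (rule ext) (simp add: lowpart_def lpu_def pfilter_single pfilter_0)

lemma lowpart_lpu_not_low: "\<not> low \<Delta> j m \<Longrightarrow> lowpart \<Delta> (lpu j (Poly_Mapping.single m c)) = 0"
  by (rule ext) (simp add: lowpart_def lpu_def pfilter_single pfilter_0 fun_at)

lemma Cgens_single_mult:
  assumes "b \<in> Cgens s \<Delta>"
  obtains j \<nu> where "j < s" "low \<Delta> j \<nu>" "(\<lambda>i. Poly_Mapping.single m c * b i) = lpu j (Poly_Mapping.single \<nu> c)"
proof -
  obtain j k l where b: "b = lpu j (lpvar k l)" and j: "j < s" and l: "l < \<Delta> j"
    using assms unfolding Cgens_def by blast
  have "(\<lambda>i. Poly_Mapping.single m c * b i) = lpu j (Poly_Mapping.single (m + Poly_Mapping.single (k, l) 1) c)"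
    by (rule ext) (simp add: b lpu_def lpvar_def mult_single)
  moreover have "low \<Delta> j (m + Poly_Mapping.single (k, l) 1)"
    unfolding low_def using l by (intro exI[of _ k] exI[of _ l]) (simp add: lookup_add)
  ultimately show ?thesis
    using that j by blast
qed

text \<open>Modulo \<open>J\<close>, \<open>C\<close> is spanned by terms with a low column, whereas
  a run from \<open>\<Delta> j\<close> on has none.\<close>

lemma unemb_C: "v \<in> Cmod \<Longrightarrow> unemb \<Delta> v \<in> IV s I"
proof (induction v rule: lp_sub_additive_induct)
  case (ideal v)
  then show ?case
    by (rule unemb_JV[OF I])
next
  case (add v u)
  then show ?case
    by (simp add: unemb_add IV_add[OF I])
next
  case (single b m c)
  obtain j \<nu> where \<nu>: "low \<Delta> j \<nu>" and eq: "(\<lambda>i. Poly_Mapping.single m c * b i) = lpu j (Poly_Mapping.single \<nu> c)"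
    using single by (rule Cgens_single_mult)
  have "\<nu> \<noteq> colw (\<Delta> j) w" for w
    using \<nu> not_low_colw by metis
  then have "unemb \<Delta> (lpu j (Poly_Mapping.single \<nu> c)) = 0"
    by (intro ext) (simp add: unemb_def lpu_def lookup_single fun_at)
  then show ?case
    by (simp only: eq IV_0[OF I])
qed

lemma JV_uminus: "v \<in> JV s I \<Longrightarrow> - v \<in> JV s I"
  using JV_mult[of v s I "-1"] by (simp add: fun_Compl_def)

lemma lowpart_C:
  assumes "v \<in> Cmod"
  shows "lowpart \<Delta> v - v \<in> JV s I"
  using assms
proof (induction v rule: lp_sub_additive_induct)
  case (ideal v)
  then show ?case
    using JV_add[OF lowpart_JV[OF I] JV_uminus] by simp
next
  case (add v u)
  then have "(lowpart \<Delta> v - v) + (lowpart \<Delta> u - u) \<in> JV s I"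
    by (rule JV_add)
  then show ?case
    by (simp add: lowpart_add algebra_simps)
next
  case (single b m c)
  obtain j \<nu> where \<nu>: "low \<Delta> j \<nu>" and eq: "(\<lambda>i. Poly_Mapping.single m c * b i) = lpu j (Poly_Mapping.single \<nu> c)"
    using single by (rule Cgens_single_mult)
  then show ?case
    using JV_0 by (simp add: eq lowpart_lpu_low)
qed

lemma lpu_sum: "lpu j (\<Sum>x\<in>X. f x) = (\<Sum>x\<in>X. lpu j (f x))"
  by (rule ext) (simp add: sum_fun_at lpu_def)

text \<open>If \<open>b\<close> has no constant terms, then a monomial \<open>\<mu>\<close> with a low column \<open>l\<close> maps the part of
  \<open>L b\<close> at \<open>\<epsilon>'\<^sub>j\<close> to a multiple of \<open>\<epsilon>'\<^sub>j x\<^sub>k\<^sub>l\<close> by an element of positive degree.\<close>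
lemma lowpart_single_mult_emb:
  assumes b: "b \<in> ncvec s" and nc: "\<And>j. b j [] = 0"
  shows "lowpart \<Delta> (\<lambda>i. Poly_Mapping.single \<mu> c * emb \<Delta> b i) \<in> lpv.span (aug s I (Cgens s \<Delta>))"
proof -
  let ?x = "\<lambda>i. Poly_Mapping.single \<mu> c * emb \<Delta> b i"
  have "?x = (\<Sum>j<s. lpu j (?x j))"
  proof
    fix i
    have "?x i = 0" if "\<not> i < s"
      using b that by (simp add: emb_def ncvec_beyond)
    then show "?x i = (\<Sum>j<s. lpu j (?x j)) i"
      by (simp add: sum_fun_at lpu_def sum.delta')
  qed
  also have "\<dots> = (\<Sum>j<s. \<Sum>w\<in>{w. b j w \<noteq> 0}. lpu j (Poly_Mapping.single (\<mu> + colw (\<Delta> j) w) (c * b j w)))"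
    by (simp add: emb_def single_mult_lpi lpu_sum)
  finally have x: "?x = \<dots>" .
  show ?thesis
    unfolding x lowpart_sum
  proof (intro lpv.span_sum)
    fix j w
    assume j: "j \<in> {..<s}" and w: "w \<in> {w. b j w \<noteq> 0}"
    let ?m = "\<mu> + colw (\<Delta> j) w" and ?c = "c * b j w"
    show "lowpart \<Delta> (lpu j (Poly_Mapping.single ?m ?c)) \<in> lpv.span (aug s I (Cgens s \<Delta>))"
    proof (cases "low \<Delta> j ?m")
      case True
      \<comment> \<open>The columns of \<open>colw (\<Delta> j) w\<close> start at
        \<open>\<Delta> j\<close>, so the low column comes from \<open>\<mu>\<close>.\<close>
      then have "low \<Delta> j \<mu>"
        by (auto simp: low_colw)
      then obtain k l where l: "l < \<Delta> j" and kl: "Poly_Mapping.lookup \<mu> (k, l) \<noteq> 0"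
        unfolding low_def by blast
      obtain \<mu>' where \<mu>: "\<mu> = \<mu>' + Poly_Mapping.single (k, l) 1"
        using kl by (rule lookup_pos_split)
      have "w \<noteq> []"
        using nc w by auto
      then have "\<mu>' + colw (\<Delta> j) w \<noteq> 0"
        by (metis length_0_conv mdeg_0 mdeg_colw lpm_add_eq_0)
      moreover have "lpu j (lpvar k l) \<in> Cgens s \<Delta>"
        using j l by (auto simp: Cgens_def)
      ultimately have "(\<lambda>i. Poly_Mapping.single (\<mu>' + colw (\<Delta> j) w) ?c * lpu j (lpvar k l) i)
          \<in> lpv.span (aug s I (Cgens s \<Delta>))"
        by (intro lpv.span_base aug_single)
      also have "(\<lambda>i. Poly_Mapping.single (\<mu>' + colw (\<Delta> j) w) ?c * lpu j (lpvar k l) i) = lpu j (Poly_Mapping.single ?m ?c)"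
        by (rule ext) (simp add: lpu_def lpvar_def mult_single \<mu> add_ac)
      finally show ?thesis
        using True by (simp add: lowpart_lpu_low)
    next
      case False
      then show ?thesis
        by (simp add: lowpart_lpu_not_low lpv.span_zero)
    qed
  qed
qed

text \<open>Right multiplication by a word corresponds to multiplication by a shifted monomial, by
  \<open>emb_mult_mono\<close>. Hence \<open>L (K)\<close> is generated by the images of any
  homogeneous generators of \<open>K\<close>.\<close>

lemma emb_in_lp_sub:
  assumes B: "\<And>b. b \<in> B \<Longrightarrow> \<exists>d. nc_vhom \<Delta> d b" "B \<subseteq> ncvec s"
    and v: "v \<in> nc_rsub s I B" and sub: "nc_rsub s I B \<subseteq> ncvec s"
  shows "emb \<Delta> v \<in> lp_sub s (lpJ I) (emb \<Delta> ` B)"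
  using I v B(2)
proof (induction v rule: nc_rsub_additive_induct)
  case (ideal v)
  then show ?case
    by (intro JV_lp_sub emb_IV[OF I])
next
  case (add v u)
  then have "v \<in> ncvec s" "u \<in> ncvec s"
    using sub by auto
  then have "emb \<Delta> (v + u) = emb \<Delta> v + emb \<Delta> u"
    by (intro ext) (simp add: emb_def plus_at lpi_add ncvecD)
  then show ?case
    using lp_sub.add[OF add(3,4)] by simp
next
  case (mono b w c)
  then obtain d where "nc_vhom \<Delta> d b"
    using B by blast
  then have "emb \<Delta> (\<lambda>i. ncmult (b i) (ncmono w c)) = (\<lambda>i. Poly_Mapping.single (colw d w) c * emb \<Delta> b i)"
    using mono B by (intro emb_mult_mono) auto
  then show ?case
    using mono by (simp add: lp_sub.smult lp_sub.gen)
qed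

text \<open>Carries a relation among letterplace generators back to \<open>F^s\<close>: monomial
  multiples of \<open>emb \<Delta> b\<close> turn into right multiples of \<open>b\<close> or 0, and
  \<open>C\<close> turns into vectors over \<open>I\<close>.\<close>

lemma unemb_in_nc_rsub:
  assumes B: "\<And>b. b \<in> B \<Longrightarrow> \<exists>d. nc_vhom \<Delta> d b" "B \<subseteq> ncvec s" and BC: "BC \<subseteq> Cmod"
    and v: "v \<in> lp_sub s (lpJ I) (emb \<Delta> ` B \<union> BC)"
  shows "unemb \<Delta> v \<in> nc_rsub s I B"
proof -
  have IV: "v \<in> nc_rsub s I B" if "v \<in> IV s I" for v
    using that by (intro nc_rsub.ideal) (auto simp: IV_def)
  show ?thesis
    using v
  proof (induction v rule: lp_sub_additive_induct)
    case (ideal v)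
    then show ?case
      by (intro IV unemb_JV[OF I])
  next
    case (add v u)
    then show ?case
      by (simp add: unemb_add nc_rsub.add)
  next
    case (single x m c)
    then consider b where "b \<in> B" "x = emb \<Delta> b" | "x \<in> BC"
      by blast
    then show ?case
    proof cases
      case 1
      then obtain d where b: "b \<in> ncvec s" "nc_vhom \<Delta> d b"
        using B by blast
      have "(\<lambda>i. ncmult (b i) (ncmono u c)) \<in> nc_rsub s I B" for u
        using 1(1) by (intro nc_rsub.rmult nc_rsub.gen ncpoly_mono)
      then show ?thesis
        unfolding 1(2) using unemb_single_mult_emb[OF b, of m c] IV[OF IV_0[OF I]] by metis
    next
      case 2
      then show ?thesis
        using BC by (intro IV unemb_C lp_sub.smult) auto
    qed
  qed
qed

text \<open>Generation follows from \<open>lpsyz_split\<close>. If the image of some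
  \<open>b \<in> BK\<close> were redundant, \<open>unemb\<close> would make \<open>b\<close>
  redundant; if an element of \<open>BC\<close> were redundant, \<open>lowpart\<close> would give a
  dependence modulo \<open>C \<mm>\<close>, against \<open>lp_minbasis_not_in_span\<close>.\<close>

lemma minbasis_lpsyz:
  assumes BK: "nc_minbasis s I \<Delta> (syz s I g) BK" and BC: "lp_minbasis s (lpJ I) \<Delta> Cmod BC"
    and nc: "\<forall>b\<in>syz s I g. \<forall>d j. nc_vhom \<Delta> d b \<longrightarrow> b j [] = 0"
  shows "lp_minbasis s (lpJ I) \<Delta> (lpsyz s I g) (emb \<Delta> ` BK \<union> BC)"
    and "emb \<Delta> ` BK \<inter> BC = {}" and "inj_on (emb \<Delta>) BK"
proof -
  have BK_vec: "BK \<subseteq> ncvec s" and BK_hom: "\<And>b. b \<in> BK \<Longrightarrow> \<exists>d. nc_vhom \<Delta> d b"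
    and BK_gen: "nc_rsub s I BK = syz s I g" and BK_min: "\<And>b. b \<in> BK \<Longrightarrow> b \<notin> nc_rsub s I (BK - {b})"
    using BK by (auto simp: nc_minbasis_def)
  have BC_vec: "BC \<subseteq> lpvec s" and BC_hom: "\<And>b. b \<in> BC \<Longrightarrow> \<exists>d. lp_vhom \<Delta> d b"
    and BC_gen: "lp_sub s (lpJ I) BC = Cmod"
    using BC by (auto simp: lp_minbasis_def)
  have BC_C: "BC \<subseteq> Cmod"
    using BC_gen lp_sub.gen by blast
  have BK_syz: "BK \<subseteq> syz s I g"
    using BK_gen nc_rsub.gen by blast
  show inj: "inj_on (emb \<Delta>) BK"
    by (rule inj_onI) (metis BK_vec subsetD unemb_emb)
  show disj: "emb \<Delta> ` BK \<inter> BC = {}"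
  proof (rule ccontr)
    assume "emb \<Delta> ` BK \<inter> BC \<noteq> {}"
    then obtain b where b: "b \<in> BK" "emb \<Delta> b \<in> Cmod"
      using BC_C by blast
    \<comment> \<open>\<open>unemb\<close> recovers \<open>b\<close> but maps \<open>C\<close> to
      zero modulo \<open>I\<close>, so \<open>b\<close> would be zero in the free
      \<open>A\<close>-module and thus redundant.\<close>
    then have "b \<in> IV s I"
      using unemb_C unemb_emb BK_vec by (metis subsetD)
    then have "b \<in> nc_rsub s I (BK - {b})"
      by (intro nc_rsub.ideal) (auto simp: IV_def)
    then show False
      using BK_min b(1) by blast
  qed
  let ?G = "emb \<Delta> ` BK \<union> BC"
  have gen: "lp_sub s (lpJ I) ?G = lpsyz s I g"
  proof
    have "emb \<Delta> ` BK \<subseteq> lpsyz s I g"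
      using BK_syz emb_syz_lpsyz by blast
    moreover have "Cmod \<subseteq> lpsyz s I g"
      using lp_sub_lpsyz[OF _ Cgens_lpsyz] by blast
    ultimately have "?G \<subseteq> lpsyz s I g"
      using BC_C by blast
    then show "lp_sub s (lpJ I) ?G \<subseteq> lpsyz s I g"
      using lp_sub_lpsyz by blast
    show "lpsyz s I g \<subseteq> lp_sub s (lpJ I) ?G"
    proof
      fix v
      assume "v \<in> lpsyz s I g"
      then obtain c u where c: "c \<in> Cmod" and u: "u \<in> Lsyz s I g \<Delta>" and v: "v = c + u"
        by (rule lpsyz_split)
      have "c \<in> lp_sub s (lpJ I) BC"
        by (simp add: BC_gen c)
      then have "c \<in> lp_sub s (lpJ I) ?G"
        by (rule lp_sub_subset) (auto intro: lp_sub.gen)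
      moreover have "emb \<Delta> ` syz s I g \<subseteq> lp_sub s (lpJ I) (emb \<Delta> ` BK)"
        using emb_in_lp_sub[OF BK_hom BK_vec] BK_gen syz_ncvec by blast
      then have "u \<in> lp_sub s (lpJ I) (emb \<Delta> ` BK)"
        using u unfolding Lsyz_def by (rule lp_sub_subset[rotated])
      then have "u \<in> lp_sub s (lpJ I) ?G"
        by (rule lp_sub_subset) (auto intro: lp_sub.gen)
      ultimately show "v \<in> lp_sub s (lpJ I) ?G"
        unfolding v by (rule lp_sub.add)
    qed
  qed
  have min: "x \<notin> lp_sub s (lpJ I) (?G - {x})" if xG: "x \<in> ?G" for x
  proof
    assume x: "x \<in> lp_sub s (lpJ I) (?G - {x})"
    consider b where "b \<in> BK" "x = emb \<Delta> b" | "x \<in> BC"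
      using xG by blast
    then show False
    proof cases
      case 1
      have "?G - {x} \<subseteq> emb \<Delta> ` (BK - {b}) \<union> BC"
        using 1 by blast
      then have "x \<in> lp_sub s (lpJ I) (emb \<Delta> ` (BK - {b}) \<union> BC)"
        using x by (intro lp_sub_subset[OF x]) (blast intro: lp_sub.gen)
      then have "unemb \<Delta> x \<in> nc_rsub s I (BK - {b})"
        using BK_hom BK_vec by (intro unemb_in_nc_rsub[OF _ _ BC_C]) auto
      moreover have "unemb \<Delta> x = b"
        using 1 BK_vec unemb_emb by blast
      ultimately show False
        using BK_min 1 by blast
    next
      case 2
      \<comment> \<open>The first set spans \<open>C \<mm>\<close>, so \<open>?W\<close> consists of
        the linear combinations of the other elements of \<open>BC\<close> modulo
        \<open>C \<mm>\<close>.\<close>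
      let ?W = "lpv.span (aug s I BC \<union> (BC - {x}))"
      have JVW: "z \<in> ?W" if "z \<in> JV s I" for z
        using that by (simp add: lpv.span_base aug_JV)
      have aug_W: "lpv.span (aug s I (Cgens s \<Delta>)) \<subseteq> ?W"
      proof -
        have "lpv.span (aug s I (Cgens s \<Delta>)) = lpv.span (aug s I BC)"
          using span_aug_lp_sub[of s I "Cgens s \<Delta>"] span_aug_lp_sub[of s I BC] by (simp add: BC_gen)
        then show ?thesis
          using lpv.span_mono[of "aug s I BC" "aug s I BC \<union> (BC - {x})"] by blast
      qed
      have "lowpart \<Delta> v \<in> ?W" if "v \<in> lp_sub s (lpJ I) (emb \<Delta> ` BK \<union> (BC - {x}))" for v
        using that
      proof (induction v rule: lp_sub_additive_induct)
        case (ideal v)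
        then show ?case
          by (intro JVW lowpart_JV[OF I])
      next
        case (add v u)
        then show ?case
          by (simp add: lowpart_add lpv.span_add)
      next
        case (single y m c)
        then consider b where "b \<in> BK" "y = emb \<Delta> b" | "y \<in> BC - {x}"
          by blast
        then show ?case
        proof cases
          case 1
          then obtain d where "nc_vhom \<Delta> d b"
            using BK_hom by blast
          then show ?thesis
            unfolding 1(2) using 1(1) BK_syz BK_vec nc
            by (intro subsetD[OF aug_W] lowpart_single_mult_emb) auto
        next
          case 2
          let ?y = "\<lambda>i. Poly_Mapping.single m c * y i"
          have "?y \<in> Cmod"
            using 2 BC_C by (intro lp_sub.smult) auto
          then have "lowpart \<Delta> ?y - ?y \<in> ?W"
            by (intro JVW lowpart_C)
          moreover have "?y \<in> ?W"
          proof (cases "m = 0")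
            case True
            have "lpscale c y \<in> ?W"
              using 2 by (intro lpv.span_scale lpv.span_base) simp
            then show ?thesis
              using True by (simp add: lpscale_def[of c y])
          next
            case False
            then show ?thesis
              using 2 by (intro lpv.span_base UnI1 aug_single) auto
          qed
          ultimately have "(lowpart \<Delta> ?y - ?y) + ?y \<in> ?W"
            by (rule lpv.span_add)
          then show ?thesis
            by simp
        qed
      qed
      moreover have "?G - {x} \<subseteq> emb \<Delta> ` BK \<union> (BC - {x})"
        by blast
      then have "x \<in> lp_sub s (lpJ I) (emb \<Delta> ` BK \<union> (BC - {x}))"
        using x by (intro lp_sub_subset[OF x]) (blast intro: lp_sub.gen)
      ultimately have "lowpart \<Delta> x \<in> ?W"
        by blast
      \<comment> \<open>An element of \<open>C\<close> agrees with its low part modulo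
        \<open>J\<close>.\<close>
      moreover have "lowpart \<Delta> x - x \<in> ?W"
        using 2 BC_C by (intro JVW lowpart_C) auto
      ultimately have "lowpart \<Delta> x - (lowpart \<Delta> x - x) \<in> ?W"
        by (rule lpv.span_diff)
      then have "x \<in> ?W"
        by simp
      then show False
        using lp_minbasis_not_in_span[OF I BC 2] by blast
    qed
  qed
  have "?G \<subseteq> lpvec s"
    using BK_vec BC_vec emb_lpvec by blast
  moreover have "\<exists>d. lp_vhom \<Delta> d x" if "x \<in> ?G" for x
    using that BC_hom BK_hom BK_vec lp_vhom_emb by blast
  ultimately show "lp_minbasis s (lpJ I) \<Delta> (lpsyz s I g) ?G"
    using gen min by (simp add: lp_minbasis_def)
qed

end

section \<open>Finiteness of bases in each degree\<close>

lemma subspace_nc_rsub: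
  fixes I :: "('x list \<Rightarrow> 'k::field) set"
  assumes I: "nc_graded_ideal I"
  shows "ncv.subspace (nc_rsub s I G)"
proof (rule ncv.subspaceI)
  show "0 \<in> nc_rsub s I G"
    using IV_0[OF I, of s] by (intro nc_rsub.ideal) (auto simp: IV_def)
  show "ncscale c v \<in> nc_rsub s I G" if "v \<in> nc_rsub s I G" for c v
  proof -
    have "ncscale c v = (\<lambda>i. ncmult (v i) (ncmono [] c))"
      by (simp add: ncscale_def ncmult_scalar_right mult.commute)
    then show ?thesis
      using nc_rsub.rmult[OF that ncpoly_mono, of "[]" c] by simp
  qed
qed (rule nc_rsub.add)

text \<open>The elements of degree \<open>d\<close> are linearly independent over the field, by
  minimality, and lie in the span of the finitely many \<open>\<epsilon>\<^sub>j w\<close> with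
  words of length at most \<open>d\<close> over the finite alphabet.\<close>

lemma finite_nc_minbasis_degree:
  fixes I :: "('x::finite list \<Rightarrow> 'k::field) set"
  assumes I: "nc_graded_ideal I" and B: "nc_minbasis s I \<delta> N B"
  shows "finite {b \<in> B. nc_vhom \<delta> d b}"
proof -
  let ?Y = "(\<lambda>(j, w). ncunit j w 1) ` ({..<s} \<times> {w. set w \<subseteq> (UNIV :: 'x set) \<and> length w \<le> d}) :: (nat \<Rightarrow> 'x list \<Rightarrow> 'k) set"
  have fin: "finite ?Y"
    by (intro finite_imageI finite_cartesian_product finite_lists_length_le) auto
  have ind: "x \<notin> ncv.span ({} \<union> ({b \<in> B. nc_vhom \<delta> d b} - {x}))" if "x \<in> {b \<in> B. nc_vhom \<delta> d b}" for x
  proof -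
    have "ncv.span ({} \<union> ({b \<in> B. nc_vhom \<delta> d b} - {x})) \<subseteq> nc_rsub s I (B - {x})"
      by (rule ncv.span_minimal[OF _ subspace_nc_rsub[OF I]]) (auto intro: nc_rsub.gen)
    then show ?thesis
      using B that by (auto simp: nc_minbasis_def)
  qed
  have "x \<in> ncv.span ({} \<union> ?Y)" if x: "x \<in> ncvec s" "nc_vhom \<delta> d x" for x
  proof -
    have "x = (\<Sum>j<s. \<Sum>w\<in>{w. x j w \<noteq> 0}. ncscale (x j w) (ncunit j w 1))"
    proof
      fix i
      have "(\<Sum>w\<in>{w. x j w \<noteq> 0}. ncscale (x j w) (ncunit j w 1) i) = (if j = i then x i else 0)" for j
      proof (cases "j = i")
        case True
        have "ncscale (x j w) (ncunit j w 1) i = ncmono w (x i w)" for w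
          by (rule ext) (simp add: True ncscale_def ncunit_def ncmono_apply)
        then show ?thesis
          using ncpoly_expand[OF ncvecD[OF x(1), of i]] True by simp
      next
        case False
        have "ncscale (x j w) (ncunit j w 1) i = 0" for w
          using False by (intro ext) (auto simp: ncscale_def ncunit_def fun_at)
        then show ?thesis
          using False by simp
      qed
      then show "x i = (\<Sum>j<s. \<Sum>w\<in>{w. x j w \<noteq> 0}. ncscale (x j w) (ncunit j w 1)) i"
        using ncvec_beyond[OF x(1), of i] by (simp add: sum_fun_at[where ?'b = nat] sum.delta')
    qed
    also have "\<dots> \<in> ncv.span ({} \<union> ?Y)"
    proof (intro ncv.span_sum ncv.span_scale ncv.span_base)
      fix j w
      assume j: "j \<in> {..<s}" and w: "w \<in> {w. x j w \<noteq> 0}"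
      have "length w + \<delta> j = d"
        using x(2) w unfolding nc_vhom_def by blast
      then show "ncunit j w 1 \<in> {} \<union> ?Y"
        using j by (intro UnI2 image_eqI[of _ _ "(j, w)"]) auto
    qed
    finally show ?thesis .
  qed
  then have "{b \<in> B. nc_vhom \<delta> d b} \<subseteq> ncv.span ({} \<union> ?Y)"
    using B by (auto simp: nc_minbasis_def)
  from ncv.card_le_modulo[OF ind this fin] show ?thesis
    by blast
qed

lemma lp_vhom_lpu_lpvar: "lp_vhom \<Delta> (Suc (\<Delta> j)) (lpu j (lpvar k l))"
  by (auto simp: lp_vhom_def lpu_def lpvar_def)

lemma finite_Cgens: "finite (Cgens s \<Delta> :: (nat \<Rightarrow> ('x::finite, 'k::comm_ring_1) lp) set)"
proof -
  have "(Cgens s \<Delta> :: (nat \<Rightarrow> ('x, 'k) lp) set) \<subseteq> (\<lambda>(j, k, l). lpu j (lpvar k l)) ` (SIGMA j:{..<s}. UNIV \<times> {..<\<Delta> j})"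
  proof
    fix v :: "nat \<Rightarrow> ('x, 'k) lp"
    assume "v \<in> Cgens s \<Delta>"
    then obtain j k l where "v = lpu j (lpvar k l)" "j < s" "l < \<Delta> j"
      unfolding Cgens_def by blast
    then show "v \<in> (\<lambda>(j, k, l). lpu j (lpvar k l)) ` (SIGMA j:{..<s}. UNIV \<times> {..<\<Delta> j})"
      by (intro image_eqI[of _ _ "(j, k, l)"]) auto
  qed
  then show ?thesis
    by (rule finite_subset) simp
qed

section \<open>Constant entries of syzygies and the comparison of bases\<close>

context letterplace_syzygies
begin

text \<open>A syzygy with a nonzero constant entry would express one generator by the others.\<close>
lemma syzygy_no_constant:
  assumes inj: "inj_on g {..<s}" and min: "\<And>j. j < s \<Longrightarrow> g j \<notin> nc_rsub r I (g ` {..<s} - {g j})"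
    and v: "v \<in> syz s I g" "nc_vhom \<Delta> d v"
  shows "v j [] = 0"
proof (rule ccontr)
  assume nz: "v j [] \<noteq> 0"
  define c where "c = v j []"
  have vec: "v \<in> ncvec s"
    by (rule syz_ncvec[OF v(1)])
  have j: "j < s"
    using nz ncvec_beyond[OF vec, of j] by (cases "j < s") (auto simp: fun_at)
  \<comment> \<open>Homogeneity ties \<open>d\<close> to the constant term, and no longer word fits
    the same degree at \<open>j\<close>; so \<open>v j\<close> is a constant.\<close>
  have "d = \<Delta> j"
    using v(2) nz unfolding nc_vhom_def by fastforce
  then have "v j w = 0" if "w \<noteq> []" for w
    using v(2) that unfolding nc_vhom_def by fastforce
  then have vj: "v j = ncmono [] c"
    by (intro ext) (simp add: ncmono_apply c_def)
  let ?W = "nc_rsub r I (g ` {..<s} - {g j})"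
  note W = subspace_nc_rsub[OF I, of r "g ` {..<s} - {g j}"]
  let ?X = "\<lambda>j' i. ncmult (g j' i) (v j')"
  have "phi s g v = (\<Sum>j'<s. ?X j')"
    by (rule ext) (simp add: phi_def sum_fun_at[where ?'b = nat])
  also have "\<dots> = ?X j + (\<Sum>j'\<in>{..<s} - {j}. ?X j')"
    using j by (simp add: sum.remove)
  finally have eq: "phi s g v = ncscale c (g j) + (\<Sum>j'\<in>{..<s} - {j}. ?X j')"
    by (simp add: vj ncmult_scalar_right ncscale_def mult.commute)
  have "(\<Sum>j'\<in>{..<s} - {j}. ?X j') \<in> ?W"
  proof (rule ncv.subspace_sum[OF W])
    fix j'
    assume "j' \<in> {..<s} - {j}"
    \<comment> \<open>Distinct indices have distinct generators, so \<open>g j'\<close> survives the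
      removal of \<open>g j\<close>.\<close>
    then have "g j' \<in> g ` {..<s} - {g j}"
      using inj j by (auto dest: inj_onD)
    then show "?X j' \<in> ?W"
      by (intro nc_rsub.rmult nc_rsub.gen ncvecD[OF vec])
  qed
  \<comment> \<open>A syzygy is mapped to zero in \<open>A^r\<close>, which lies in every
    submodule.\<close>
  moreover have "phi s g v \<in> ?W"
  proof (rule nc_rsub.ideal)
    have "phi s g v i = 0" if "r \<le> i" for i
      unfolding phi_def using ncvec_beyond[OF g_vec that] by (intro sum.neutral) simp
    then show "phi s g v \<in> ncvec r"
      using v(1) ideal_ncpoly[OF I] by (auto simp: ncvec_def syz_def)
    show "\<forall>i. phi s g v i \<in> I"
      using v(1) by (simp add: syz_def)
  qed
  ultimately have "phi s g v - (\<Sum>j'\<in>{..<s} - {j}. ?X j') \<in> ?W"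
    by (intro ncv.subspace_diff[OF W])
  then have "ncscale c (g j) \<in> ?W"
    by (simp add: eq)
  then have "ncscale (inverse c) (ncscale c (g j)) \<in> ?W"
    by (rule ncv.subspace_scale[OF W])
  then show False
    using min[OF j] nz by (simp add: c_def)
qed

text \<open>\<open>BK'\<close> and the basis built from \<open>BK\<close> and \<open>BC\<close> are
  both minimal bases of the same module, so \<open>lp_minbasis_card_le\<close> bounds their numbers
  in degree \<open>d\<close> in both directions. Finiteness for \<open>BC\<close> comes from the
  finite set \<open>Cgens\<close>.\<close>

lemma minbasis_counts:
  fixes BK' BC
  assumes BK: "nc_minbasis s I \<Delta> (syz s I g) BK" and BC: "lp_minbasis s (lpJ I) \<Delta> Cmod BC"
    and BK': "lp_minbasis s (lpJ I) \<Delta> (lpsyz s I g) BK'"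
    and nc: "\<forall>b\<in>syz s I g. \<forall>d j. nc_vhom \<Delta> d b \<longrightarrow> b j [] = 0"
    and fin_BK: "finite {b \<in> BK. nc_vhom \<Delta> d b}"
    and fin_Cgens: "finite (Cgens s \<Delta> :: (nat \<Rightarrow> ('x, 'k) lp) set)"
  shows "finite {b \<in> BK'. lp_vhom \<Delta> d b}" "finite {b \<in> BC. lp_vhom \<Delta> d b}"
    "card {b \<in> BK. nc_vhom \<Delta> d b} + card {b \<in> BC. lp_vhom \<Delta> d b} = card {b \<in> BK'. lp_vhom \<Delta> d b}"
proof -
  have "\<exists>d. lp_vhom \<Delta> d b" if "b \<in> Cgens s \<Delta>" for b :: "nat \<Rightarrow> ('x, 'k) lp"
    using that lp_vhom_lpu_lpvar by (fastforce simp: Cgens_def)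
  then show fin_BC: "finite {b \<in> BC. lp_vhom \<Delta> d b}"
    using lp_minbasis_card_le[OF I BC refl, of d] fin_Cgens by simp
  let ?G = "emb \<Delta> ` BK \<union> BC"
  note G = minbasis_lpsyz[OF BK BC nc]
  have BK_vec: "BK \<subseteq> ncvec s"
    using BK by (simp add: nc_minbasis_def)
  have Gd: "{b \<in> ?G. lp_vhom \<Delta> d b} = emb \<Delta> ` {b \<in> BK. nc_vhom \<Delta> d b} \<union> {b \<in> BC. lp_vhom \<Delta> d b}"
    using BK_vec lp_vhom_emb by blast
  have fin_G: "finite {b \<in> ?G. lp_vhom \<Delta> d b}"
    unfolding Gd using fin_BK fin_BC by simp
  have le: "finite {b \<in> BK'. lp_vhom \<Delta> d b} \<and> card {b \<in> BK'. lp_vhom \<Delta> d b} \<le> card {b \<in> ?G. lp_vhom \<Delta> d b}"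
    using G(1) by (intro lp_minbasis_card_le[OF I BK' _ _ fin_G]) (auto simp: lp_minbasis_def)
  then show "finite {b \<in> BK'. lp_vhom \<Delta> d b}"
    by simp
  then have ge: "card {b \<in> ?G. lp_vhom \<Delta> d b} \<le> card {b \<in> BK'. lp_vhom \<Delta> d b}"
    using BK' lp_minbasis_card_le[OF I G(1), of BK' d] by (simp add: lp_minbasis_def)
  have "card {b \<in> ?G. lp_vhom \<Delta> d b}
      = card (emb \<Delta> ` {b \<in> BK. nc_vhom \<Delta> d b}) + card {b \<in> BC. lp_vhom \<Delta> d b}"
    unfolding Gd using fin_BK fin_BC G(2) by (intro card_Un_disjoint) auto
  also have "card (emb \<Delta> ` {b \<in> BK. nc_vhom \<Delta> d b}) = card {b \<in> BK. nc_vhom \<Delta> d b}"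
    by (rule card_image) (rule inj_on_subset[OF G(3)], blast)
  finally show "card {b \<in> BK. nc_vhom \<Delta> d b} + card {b \<in> BC. lp_vhom \<Delta> d b} = card {b \<in> BK'. lp_vhom \<Delta> d b}"
    using le ge by simp
qed

end

theorem mainTheorem12:
  fixes I :: "('x::finite list \<Rightarrow> 'k::field) set"
    and r s :: nat and g :: "nat \<Rightarrow> nat \<Rightarrow> 'x list \<Rightarrow> 'k" and \<Delta> :: "nat \<Rightarrow> nat"
  assumes I: "nc_graded_ideal I"
    and g_hom: "\<forall>j<s. nc_vhom (\<lambda>_. 0) (\<Delta> j) (g j)"
    and g_inj: "inj_on g {..<s}"
    and g_min: "nc_minbasis r I (\<lambda>_. 0) (nc_rsub r I (g ` {..<s})) (g ` {..<s})"
  defines "K \<equiv> {v \<in> ncvec s. \<forall>i. (\<Sum>j<s. ncmult (g j i) (v j)) \<in> I}"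
    and "K' \<equiv> {v \<in> lpvec s. \<forall>i. (\<Sum>j<s. lpiota (g j i) * v j) \<in> lpJ I}"
    and "C \<equiv> lp_sub s (lpJ I)
               {(\<lambda>i. if i = j then lpvar k l else 0) | j k l. j < s \<and> l < \<Delta> j}"
    and "LK \<equiv> lp_sub s (lpJ I) (lp_embed \<Delta> ` {v \<in> ncvec s. \<forall>i. (\<Sum>j<s. ncmult (g j i) (v j)) \<in> I})"
  shows "K' = {c + u | c u. c \<in> C \<and> u \<in> LK} \<and>
    (\<forall>d BK BK' BC. nc_minbasis s I \<Delta> K BK \<longrightarrow> lp_minbasis s (lpJ I) \<Delta> K' BK'
        \<longrightarrow> lp_minbasis s (lpJ I) \<Delta> C BC \<longrightarrow>
       finite {b \<in> BK. nc_vhom \<Delta> d b} \<and> finite {b \<in> BK'. lp_vhom \<Delta> d b} \<and>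
       finite {b \<in> BC. lp_vhom \<Delta> d b} \<and>
       card {b \<in> BK. nc_vhom \<Delta> d b} + card {b \<in> BC. lp_vhom \<Delta> d b}
         = card {b \<in> BK'. lp_vhom \<Delta> d b})"
proof -
  interpret letterplace_syzygies I r s g \<Delta>
  proof
    show "g j \<in> ncvec r" if "j < s" for j
      using g_min that by (auto simp: nc_minbasis_def)
    show "nc_hom (\<Delta> j) (g j i)" if "j < s" for j i
      using g_hom that by (auto simp: nc_vhom_def nc_hom_def)
  qed (rule I)
  have K: "K = syz s I g"
    by (simp add: K_def syz_def phi_def)
  have K': "K' = lpsyz s I g"
    by (simp add: K'_def lpsyz_def lphi_def)
  have C: "C = Cmod"
    by (simp add: C_def Cgens_def lpu_def)
  have "lp_embed \<Delta> ` syz s I g = emb \<Delta> ` syz s I g"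
    by (rule image_cong[OF refl]) (rule lp_embed_emb[OF syz_ncvec])
  then have LK: "LK = Lsyz s I g \<Delta>"
    by (simp add: LK_def Lsyz_def K[symmetric] K_def)
  have min: "g j \<notin> nc_rsub r I (g ` {..<s} - {g j})" if "j < s" for j
    using g_min that by (auto simp: nc_minbasis_def)
  have "K' = {c + u | c u. c \<in> C \<and> u \<in> LK}"
  proof
    show "K' \<subseteq> {c + u | c u. c \<in> C \<and> u \<in> LK}"
      unfolding K' C LK using lpsyz_split by blast
    have "c + u \<in> lpsyz s I g" if "c \<in> C" "u \<in> LK" for c u
      using that lp_sub_lpsyz[OF _ Cgens_lpsyz] lp_sub_lpsyz[OF _ emb_syz_lpsyz] unfolding C LK Lsyz_def
      by (intro lpsyz_add) auto
    then show "{c + u | c u. c \<in> C \<and> u \<in> LK} \<subseteq> K'"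
      unfolding K' by blast
  qed
  moreover have "finite {b \<in> BK. nc_vhom \<Delta> d b} \<and> finite {b \<in> BK'. lp_vhom \<Delta> d b} \<and>
       finite {b \<in> BC. lp_vhom \<Delta> d b} \<and>
       card {b \<in> BK. nc_vhom \<Delta> d b} + card {b \<in> BC. lp_vhom \<Delta> d b} = card {b \<in> BK'. lp_vhom \<Delta> d b}"
    if "nc_minbasis s I \<Delta> K BK" "lp_minbasis s (lpJ I) \<Delta> K' BK'" "lp_minbasis s (lpJ I) \<Delta> C BC"
    for d BK BK' BC
  proof -
    note B = that[unfolded K K' C]
    have fin: "finite {b \<in> BK. nc_vhom \<Delta> d b}"
      by (rule finite_nc_minbasis_degree[OF I that(1)])
    \<comment> \<open>Minimality of the \<open>g j\<close> enters here, by excluding constant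
      entries of homogeneous syzygies.\<close>
    have "\<forall>b\<in>syz s I g. \<forall>d j. nc_vhom \<Delta> d b \<longrightarrow> b j [] = 0"
      using syzygy_no_constant[OF g_inj min] by blast
    from minbasis_counts[OF B(1,3,2) this fin finite_Cgens] fin show ?thesis
      by simp
  qed
  ultimately show ?thesis
    by blast
qed

end
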